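(* Let $G$ be a finite group and put $\mathcal U_{\mathrm{core}}(G):=\{u\in\Omega(G)^\times\mid \mathfrak n_G(u)=1_{\Omega(G)}\}$. Then $$\mathcal U_{\mathrm{core}}(G)=\ker\Psi=\left\{u\in\Omega(G)^\times\ \middle|\ \varphi_H^{G}(u)=1\ \text{for every core-cyclic subgroup }H\leq G\right\}.$$
   Context: For a finite group $G$, $\Omega(G)$ is the Burnside ring (Grothendieck ring of finite $G$-sets), with $\mathbb Z$-basis $[G/H]$, $(H)$ running over the conjugacy classes of subgroups of $G$, and $1_{\Omega(G)}=[G/G]$. For $K\le G$, the mark $\varphi_K^G:\Omega(G)\to\mathbb Z$ is the ring homomorphism $[X]\mapsto\#X^K$; marks of units are $\pm1$. $\operatorname{core}_G(H)=\bigcap_{g\in G}gHg^{-1}$. The normal-core compression $\mathfrak n_G:\Omega(G)\to\Omega(G)$ is the additive map with $\mathfrak n_G([G/H])=[G/\operatorname{core}_G(H)]$. A subgroup $H\le G$ is core-cyclic if $H/\operatorname{core}_G(H)$ is cyclic. For $u\in\Omega(G)^\times$ and $N\trianglelefteq G$, put $\chi_N^u(gN)=\varphi^G_{\langle N,g\rangle}(u)/\varphi_N^G(u)$. By Yoshida's known unit criterion (for every $u\in\Omega(G)^\times$ and $H\le G$ the map $N_G(H)/H\to\{\pm1\}$, $gH\mapsto\varphi^G_{\langle H,g\rangle}(u)/\varphi_H^G(u)$ is a group homomorphism), $\chi_N^u:G/N\to\{\pm1\}$ is a group homomorphism. The group homomorphism $\Psi$ is $$\Psi:\Omega(G)^\times\to\prod_{N\trianglelefteq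 G}\bigl(\{\pm1\}\times\operatorname{Hom}(G/N,\{\pm1\})\bigr),\qquad u\mapsto\bigl(\varphi_N^G(u),\chi_N^u\bigr)_{N\trianglelefteq G}.$$ *)

theory Defs
  imports "HOL-Algebra.Group_Action" "HOL-Algebra.Left_Coset" "HOL-Algebra.Ring" "HOL-Algebra.Sym_Groups"
    "HOL-Algebra.Product_Groups" "HOL-Algebra.Elementary_Groups"
begin

type_synonym ('a, 'b) gset = "'b set \<times> ('a \<Rightarrow> 'b \<Rightarrow> 'b)"

definition finite_gset :: "('a, 'm) monoid_scheme \<Rightarrow> ('a, 'b) gset \<Rightarrow> bool" where
  "finite_gset G X \<longleftrightarrow> finite (fst X) \<and> group_action G (fst X) (snd X)"

definition gset_iso :: "('a, 'm) monoid_scheme \<Rightarrow> ('a, 'b) gset \<Rightarrow> ('a, 'c) gset \<Rightarrow> bool" where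
  "gset_iso G X Y \<longleftrightarrow> (\<exists>f. bij_betw f (fst X) (fst Y) \<and>
     (\<forall>g\<in>carrier G. \<forall>x\<in>fst X. f (snd X g x) = snd Y g (f x)))"

text \<open>The restrictions to the underlying set are needed because \<^locale>\<open>group_action\<close> asks
  for extensional permutations.\<close>

definition gset_empty :: "('a, 'b) gset" where
  "gset_empty = ({}, \<lambda>g. \<lambda>x\<in>{}. x)"

definition gset_sum :: "('a, 'b) gset \<Rightarrow> ('a, 'c) gset \<Rightarrow> ('a, 'b + 'c) gset" where
  "gset_sum X Y = (fst X <+> fst Y, \<lambda>g. \<lambda>z\<in>fst X <+> fst Y. map_sum (snd X g) (snd Y g) z)"

definition gset_prod :: "('a, 'b) gset \<Rightarrow> ('a, 'c) gset \<Rightarrow> ('a, 'b \<times> 'c) gset" where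
  "gset_prod X Y = (fst X \<times> fst Y, \<lambda>g. \<lambda>z\<in>fst X \<times> fst Y. map_prod (snd X g) (snd Y g) z)"

definition coset_gset :: "('a, 'm) monoid_scheme \<Rightarrow> 'a set \<Rightarrow> ('a, 'a set) gset" where
  "coset_gset G H = (lcosets\<^bsub>G\<^esub> H, \<lambda>g. \<lambda>C\<in>lcosets\<^bsub>G\<^esub> H. g <#\<^bsub>G\<^esub> C)"

definition fixed_points :: "('a, 'b) gset \<Rightarrow> 'a set \<Rightarrow> 'b set" where
  "fixed_points X K = {x \<in> fst X. \<forall>k\<in>K. snd X k x = x}"

text \<open>Every finite \<open>G\<close>-set is isomorphic to one whose underlying set consists of natural
  numbers, so these represent all isomorphism classes.  An element of the Grothendieck ring is
  a class of formal differences \<open>(X, Y)\<close> of such \<open>G\<close>-sets.  For finite \<open>G\<close>-sets \<open>S\<close> and \<open>T\<close>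
  over arbitrary types, \<open>gset_diff G S T\<close> is the class \<open>[S] - [T]\<close>; it contains \<open>(X, Y)\<close> iff
  \<open>S + Y + Z\<close> and \<open>X + T + Z\<close> are isomorphic for some \<open>Z\<close>.\<close>

type_synonym 'a virtual_gset = "(('a, nat) gset \<times> ('a, nat) gset) set"

definition gset_diff ::
  "('a, 'm) monoid_scheme \<Rightarrow> ('a, 'b) gset \<Rightarrow> ('a, 'c) gset \<Rightarrow> 'a virtual_gset" where
  "gset_diff G S T = {(X, Y). finite_gset G X \<and> finite_gset G Y \<and>
     (\<exists>Z :: ('a, nat) gset. finite_gset G Z \<and>
        gset_iso G (gset_sum (gset_sum S Y) Z) (gset_sum (gset_sum X T) Z))}"

definition gset_class :: "('a, 'm) monoid_scheme \<Rightarrow> ('a, 'b) gset \<Rightarrow> 'a virtual_gset" where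
  "gset_class G S = gset_diff G S (gset_empty :: ('a, nat) gset)"

definition burnside_ring :: "('a, 'm) monoid_scheme \<Rightarrow> 'a virtual_gset ring" where
  "burnside_ring G =
    \<lparr>carrier = {gset_diff G S T | (S :: ('a, nat) gset) (T :: ('a, nat) gset).
       finite_gset G S \<and> finite_gset G T},
     monoid.mult = (\<lambda>u v. \<Union>(S, T)\<in>u. \<Union>(S', T')\<in>v.
       gset_diff G (gset_sum (gset_prod S S') (gset_prod T T'))
                   (gset_sum (gset_prod S T') (gset_prod T S'))),
     one = gset_class G (coset_gset G (carrier G)),
     zero = gset_class G (gset_empty :: ('a, nat) gset),
     add = (\<lambda>u v. \<Union>(S, T)\<in>u. \<Union>(S', T')\<in>v. gset_diff G (gset_sum S S') (gset_sum T T'))\<rparr>"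

text \<open>The mark of \<open>[S] - [T]\<close> at \<open>K\<close> is the number of \<open>K\<close>-fixed points of \<open>S\<close> minus that of
  \<open>T\<close>, which does not depend on the representative \<open>(S, T)\<close>.\<close>

definition mark :: "('a, 'm) monoid_scheme \<Rightarrow> 'a set \<Rightarrow> 'a virtual_gset \<Rightarrow> int" where
  "mark G K u = the_elem
     ((\<lambda>(S, T). int (card (fixed_points S K)) - int (card (fixed_points T K))) ` u)"

definition normal_core :: "('a, 'm) monoid_scheme \<Rightarrow> 'a set \<Rightarrow> 'a set" where
  "normal_core G H = (\<Inter>g\<in>carrier G. g <#\<^bsub>G\<^esub> H #>\<^bsub>G\<^esub> inv\<^bsub>G\<^esub> g)"

definition core_cyclic :: "('a, 'm) monoid_scheme \<Rightarrow> 'a set \<Rightarrow> bool" where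
  "core_cyclic G H \<longleftrightarrow> subgroup H G \<and> cyclic_group ((G\<lparr>carrier := H\<rparr>) Mod normal_core G H)"

text \<open>The classes \<open>[G/H]\<close> generate the additive group, so there is at most one such map with a
  prescribed (here: undefined) value outside the carrier; it exists because \<open>[G/H] = [G/H']\<close>
  only for conjugate \<open>H\<close> and \<open>H'\<close>, and these classes form a basis.\<close>

definition core_compression ::
  "('a, 'm) monoid_scheme \<Rightarrow> 'a virtual_gset \<Rightarrow> 'a virtual_gset" where
  "core_compression G = (THE n.
     n \<in> extensional (carrier (burnside_ring G)) \<and>
     n \<in> hom (add_monoid (burnside_ring G)) (add_monoid (burnside_ring G)) \<and>
     (\<forall>H. subgroup H G \<longrightarrow>
        n (gset_class G (coset_gset G H)) = gset_class G (coset_gset G (normal_core G H))))"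

definition U_core :: "('a, 'm) monoid_scheme \<Rightarrow> 'a virtual_gset set" where
  "U_core G = {u \<in> Units (burnside_ring G). core_compression G u = \<one>\<^bsub>burnside_ring G\<^esub>}"

definition sign_characters :: "('b, 'm) monoid_scheme \<Rightarrow> ('b \<Rightarrow> int) monoid" where
  "sign_characters Q =
    \<lparr>carrier = hom Q sign_img \<inter> extensional (carrier Q),
     monoid.mult = (\<lambda>\<chi> \<psi>. \<lambda>x\<in>carrier Q. \<chi> x * \<psi> x),
     one = (\<lambda>x\<in>carrier Q. 1)\<rparr>"

text \<open>The argument is a coset \<open>C = gN\<close>; the subgroup \<open>\<langle>N, g\<rangle>\<close> does not depend on the
  representative \<open>g\<close> of \<open>C\<close>.  Marks of units are \<open>1\<close> or \<open>-1\<close>, so the integer division is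
  exact.\<close>

definition unit_character ::
  "('a, 'm) monoid_scheme \<Rightarrow> 'a set \<Rightarrow> 'a virtual_gset \<Rightarrow> 'a set \<Rightarrow> int" where
  "unit_character G N u = (\<lambda>C\<in>carrier (G Mod N).
     the_elem ((\<lambda>g. mark G (generate G (insert g N)) u div mark G N u) ` C))"

definition Psi_target ::
  "('a, 'm) monoid_scheme \<Rightarrow> ('a set \<Rightarrow> int \<times> ('a set \<Rightarrow> int)) monoid" where
  "Psi_target G =
     product_group {N. N \<lhd> G} (\<lambda>N. sign_img \<times>\<times> sign_characters (G Mod N))"

definition Psi ::
  "('a, 'm) monoid_scheme \<Rightarrow> 'a virtual_gset \<Rightarrow> 'a set \<Rightarrow> int \<times> ('a set \<Rightarrow> int)" where
  "Psi G u = (\<lambda>N\<in>{N. N \<lhd> G}. (mark G N u, unit_character G N u))"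

end

theory Submission
  imports Defs
begin

text \<open>
  By Burnside's theorem the marks determine an element of \<open>\<Omega>(G)\<close>. For \<open>N\<close> normal, Burnside's
  lemma says that \<open>[G/H] \<mapsto> \<Sum>\<^sub>g \<phi>\<^bsub>\<langle>N,g\<rangle>\<^esub>([G/H])\<close> is \<open>|G|\<close> if \<open>N \<subseteq> H\<close> and \<open>0\<close> otherwise; since
  \<open>N \<subseteq> H\<close> iff \<open>N \<subseteq> core(H)\<close>, these sums are unchanged by the core compression \<open>n\<close>. Conversely they
  determine \<open>n(u)\<close>, whose mark at \<open>K\<close> depends only on the normal closure of \<open>K\<close> (downward induction
  on \<open>N\<close>). Hence \<open>n(u) = 1\<close> iff \<open>\<Sum>\<^sub>g \<phi>\<^bsub>\<langle>N,g\<rangle>\<^esub>(u) = |G|\<close> for all normal \<open>N\<close>, and as the marks of a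
  unit are \<open>\<plusminus>1\<close> this forces every summand to be \<open>1\<close>. The subgroups \<open>\<langle>N,g\<rangle>\<close> are exactly the
  core-cyclic ones.
\<close>

section \<open>Finite group actions and their marks\<close>

definition gset_restrict :: "('a, 'b) gset \<Rightarrow> 'b set \<Rightarrow> ('a, 'b) gset" where
  "gset_restrict X A = (A, \<lambda>g. \<lambda>x\<in>A. snd X g x)"

context group
begin

text \<open>The map \<open>a (inv g)\<close> inverts \<open>a g\<close>, so the elementary action
  laws already make every \<open>a g\<close> a bijection; extensionality then places it in
  \<open>Bij E\<close>.\<close>

lemma finite_gsetI:
  assumes "finite E"
    and closed: "\<And>g x. g \<in> carrier G \<Longrightarrow> x \<in> E \<Longrightarrow> a g x \<in> E"
    and one: "\<And>x. x \<in> E \<Longrightarrow> a \<one> x = x"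
    and mult: "\<And>g h x. g \<in> carrier G \<Longrightarrow> h \<in> carrier G \<Longrightarrow> x \<in> E \<Longrightarrow> a (g \<otimes> h) x = a g (a h x)"
    and ext: "\<And>g. g \<in> carrier G \<Longrightarrow> a g \<in> extensional E"
  shows "finite_gset G (E, a)"
proof -
  have "a g \<in> Bij E" if g: "g \<in> carrier G" for g
  proof -
    have "bij_betw (a g) E E"
    proof (rule bij_betwI[where g = "a (inv g)"])
      show "a g \<in> E \<rightarrow> E" "a (inv g) \<in> E \<rightarrow> E"
        using closed g by auto
      show "a (inv g) (a g x) = x" "a g (a (inv g) x) = x" if "x \<in> E" for x
        using mult[of "inv g" g x] mult[of g "inv g" x] one[of x] that g by simp_all
    qed
    then show ?thesis
      using ext[OF g] by (simp add: Bij_def)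
  qed
  moreover from this have "a (g \<otimes> h) = compose E (a g) (a h)"
    if "g \<in> carrier G" "h \<in> carrier G" for g h
    using that by (intro extensionalityI[of _ E]) (auto simp: compose_def mult ext)
  ultimately have "a \<in> hom G (BijGroup E)"
    by (auto simp: hom_def BijGroup_def)
  then show ?thesis
    using assms(1) by (simp add: finite_gset_def group_action_def group_hom_def group_hom_axioms_def
        group_BijGroup is_group)
qed

lemma
  assumes "finite_gset G X"
  shows gset_finite: "finite (fst X)"
    and gset_action: "group_action G (fst X) (snd X)"
    and gset_closed: "g \<in> carrier G \<Longrightarrow> x \<in> fst X \<Longrightarrow> snd X g x \<in> fst X"
    and gset_one: "x \<in> fst X \<Longrightarrow> snd X \<one> x = x"
    and gset_mult: "g \<in> carrier G \<Longrightarrow> h \<in> carrier G \<Longrightarrow> x \<in> fst X \<Longrightarrow>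
      snd X (g \<otimes> h) x = snd X g (snd X h x)"
proof -
  show *: "group_action G (fst X) (snd X)" and "finite (fst X)"
    using assms by (auto simp: finite_gset_def)
  interpret group_action G "fst X" "snd X" by fact
  show "g \<in> carrier G \<Longrightarrow> x \<in> fst X \<Longrightarrow> snd X g x \<in> fst X"
    using element_image by blast
  show "x \<in> fst X \<Longrightarrow> snd X \<one> x = x"
    by (metis id_eq_one restrict_apply')
  show "g \<in> carrier G \<Longrightarrow> h \<in> carrier G \<Longrightarrow> x \<in> fst X \<Longrightarrow> snd X (g \<otimes> h) x = snd X g (snd X h x)"
    using composition_rule by blast
qed

section \<open>Basic G-sets and their fixed-point counts\<close>

lemma finite_gset_empty: "finite_gset G gset_empty"
  unfolding gset_empty_def by (rule finite_gsetI) auto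

lemma finite_gset_sum:
  assumes "finite_gset G X" "finite_gset G Y"
  shows "finite_gset G (gset_sum X Y)"
  unfolding gset_sum_def
  by (rule finite_gsetI)
    (auto simp: assms[THEN gset_finite] gset_closed[OF assms(1)] gset_closed[OF assms(2)]
      gset_one[OF assms(1)] gset_one[OF assms(2)] gset_mult[OF assms(1)] gset_mult[OF assms(2)])

lemma finite_gset_prod:
  assumes "finite_gset G X" "finite_gset G Y"
  shows "finite_gset G (gset_prod X Y)"
  unfolding gset_prod_def
  by (rule finite_gsetI)
    (auto simp: assms[THEN gset_finite] gset_closed[OF assms(1)] gset_closed[OF assms(2)]
      gset_one[OF assms(1)] gset_one[OF assms(2)] gset_mult[OF assms(1)] gset_mult[OF assms(2)])

lemma finite_fixed_points: "finite_gset G X \<Longrightarrow> finite (fixed_points X K)"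
  using gset_finite[of X] by (simp add: fixed_points_def)

lemma card_fixed_points_empty: "card (fixed_points gset_empty K) = 0"
  by (simp add: fixed_points_def gset_empty_def)

lemma card_fixed_points_sum:
  assumes "finite_gset G X" "finite_gset G Y"
  shows "card (fixed_points (gset_sum X Y) K) = card (fixed_points X K) + card (fixed_points Y K)"
proof -
  have "fixed_points (gset_sum X Y) K = fixed_points X K <+> fixed_points Y K"
    by (auto simp: fixed_points_def gset_sum_def)
  then show ?thesis
    using assms by (simp add: card_Plus finite_fixed_points)
qed

lemma card_fixed_points_prod:
  "card (fixed_points (gset_prod X Y) K) = card (fixed_points X K) * card (fixed_points Y K)"
proof -
  have "fixed_points (gset_prod X Y) K = fixed_points X K \<times> fixed_points Y K"
    by (auto simp: fixed_points_def gset_prod_def)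
  then show ?thesis
    by (simp add: card_cartesian_product)
qed

text \<open>An equivariant bijection matches fixed points with fixed points: by injectivity,
  \<open>g\<close> fixes \<open>f x\<close> exactly when it fixes \<open>x\<close>.\<close>

lemma gset_iso_card_fixed_points:
  assumes "gset_iso G X Y" "finite_gset G X" "K \<subseteq> carrier G"
  shows "card (fixed_points X K) = card (fixed_points Y K)"
proof -
  obtain f where f: "bij_betw f (fst X) (fst Y)"
    and eq: "\<And>g x. g \<in> carrier G \<Longrightarrow> x \<in> fst X \<Longrightarrow> f (snd X g x) = snd Y g (f x)"
    using assms(1) by (auto simp: gset_iso_def)
  have fix_iff: "snd Y g (f x) = f x \<longleftrightarrow> snd X g x = x" if "g \<in> K" "x \<in> fst X" for g x
  proof -
    have "snd Y g (f x) = f (snd X g x)" "snd X g x \<in> fst X"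
      using that eq gset_closed[OF assms(2)] assms(3) by auto
    then show ?thesis
      using f that(2) by (auto simp: bij_betw_def inj_on_def)
  qed
  have "f ` fixed_points X K = {y \<in> f ` fst X. \<forall>k\<in>K. snd Y k y = y}"
    using fix_iff by (auto simp: fixed_points_def)
  then have "f ` fixed_points X K = fixed_points Y K"
    using f by (simp add: fixed_points_def bij_betw_def)
  then have "bij_betw f (fixed_points X K) (fixed_points Y K)"
    using f by (auto simp: fixed_points_def bij_betw_def intro: inj_on_subset)
  then show ?thesis
    by (rule bij_betw_same_card)
qed

text \<open>The action is transported along an enumeration of the underlying set. This lets coset
  spaces, sums and products be represented in the ring, whose elements consist of pairs of G-sets on
  naturals.\<close>

lemma ex_nat_gset:
  assumes "finite_gset G X"
  obtains Y :: "('a, nat) gset" where "finite_gset G Y" "gset_iso G Y X"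
proof -
  obtain f where f: "bij_betw f {..<card (fst X)} (fst X)"
    using gset_finite[OF assms] finite_same_card_bij[of "{..<card (fst X)}" "fst X"] by auto
  define E where "E = {..<card (fst X)}"
  define f' where "f' = inv_into E f"
  define Y where "Y = (E, \<lambda>g. \<lambda>n\<in>E. f' (snd X g (f n)))"
  have f_in: "f n \<in> fst X" if "n \<in> E" for n
    using f that by (auto simp: bij_betw_def E_def)
  have f'_in: "f' x \<in> E" "f (f' x) = x" if "x \<in> fst X" for x
    using f that unfolding f'_def E_def
    by (metis bij_betw_def inv_into_into, metis bij_betw_def f_inv_into_f)
  have f'f: "f' (f n) = n" if "n \<in> E" for n
    using f that unfolding f'_def E_def by (metis bij_betw_inv_into_left)
  have "finite_gset G Y"
    unfolding Y_def
    by (rule finite_gsetI)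
      (auto simp: E_def[symmetric] f_in f'_in f'f gset_closed[OF assms] gset_one[OF assms] gset_mult[OF assms],
        simp add: E_def)
  moreover have "gset_iso G Y X"
    unfolding gset_iso_def
  proof (intro exI[of _ f] conjI ballI)
    show "bij_betw f (fst Y) (fst X)"
      using f by (simp add: Y_def E_def)
  qed (auto simp: Y_def f_in f'_in gset_closed[OF assms])
  ultimately show ?thesis
    using that by blast
qed

section \<open>Orbits and stabilizers\<close>

lemma finite_gset_restrict:
  assumes "finite_gset G X" "A \<subseteq> fst X" "\<And>g x. g \<in> carrier G \<Longrightarrow> x \<in> A \<Longrightarrow> snd X g x \<in> A"
  shows "finite_gset G (gset_restrict X A)"
  unfolding gset_restrict_def
  by (rule finite_gsetI)
    (auto simp: assms(3) subsetD[OF assms(2)] gset_one[OF assms(1)] gset_mult[OF assms(1)]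
      intro: finite_subset[OF assms(2) gset_finite[OF assms(1)]])

abbreviation gset_orbit :: "('a, 'c) gset \<Rightarrow> 'c \<Rightarrow> ('a, 'c) gset" where
  "gset_orbit X x \<equiv> gset_restrict X (orbit G (snd X) x)"

abbreviation gset_rest :: "('a, 'c) gset \<Rightarrow> 'c \<Rightarrow> ('a, 'c) gset" where
  "gset_rest X x \<equiv> gset_restrict X (fst X - orbit G (snd X) x)"

lemma
  assumes X: "finite_gset G X" and x: "x \<in> fst X"
  shows orbit_subset: "orbit G (snd X) x \<subseteq> fst X"
    and orbit_closed: "g \<in> carrier G \<Longrightarrow> y \<in> orbit G (snd X) x \<Longrightarrow> snd X g y \<in> orbit G (snd X) x"
    and orbit_rest_closed: "g \<in> carrier G \<Longrightarrow> y \<in> fst X - orbit G (snd X) x \<Longrightarrow>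
      snd X g y \<in> fst X - orbit G (snd X) x"
    and orbit_self: "x \<in> orbit G (snd X) x"
proof -
  interpret group_action G "fst X" "snd X"
    using X by (rule gset_action)
  show sub: "orbit G (snd X) x \<subseteq> fst X"
    using gset_closed[OF X] x by (auto simp: orbit_def)
  show "x \<in> orbit G (snd X) x"
    using x by (rule orbit_refl)
  show closed: "snd X g y \<in> orbit G (snd X) x" if "g \<in> carrier G" "y \<in> orbit G (snd X) x" for g y
    using that gset_mult[OF X _ _ x, symmetric] by (auto simp: orbit_def)
  show "snd X g y \<in> fst X - orbit G (snd X) x"
    if g: "g \<in> carrier G" and y: "y \<in> fst X - orbit G (snd X) x"
  proof -
    have "y = snd X (inv g) (snd X g y)"
      using orbit_sym_aux[OF g _ refl] y by simp
    then have "snd X g y \<notin> orbit G (snd X) x"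
      using closed[of "inv g" "snd X g y"] g y by auto
    then show ?thesis
      using gset_closed[OF X g] y by simp
  qed
qed

text \<open>Tools for the two inductions on the size of a G-set, which peel off one orbit at a time.
  The rest is strictly smaller because the orbit contains \<open>x\<close>.\<close>

lemma
  assumes "finite_gset G X" "x \<in> fst X"
  shows finite_gset_orbit: "finite_gset G (gset_orbit X x)"
    and finite_gset_rest: "finite_gset G (gset_rest X x)"
    and card_gset_rest: "card (fst (gset_rest X x)) < card (fst X)"
    and card_fixed_points_orbit_rest: "card (fixed_points X K) =
      card (fixed_points (gset_orbit X x) K) + card (fixed_points (gset_rest X x) K)"
proof -
  note sub = orbit_subset[OF assms]
  show "finite_gset G (gset_orbit X x)"
    by (rule finite_gset_restrict[OF assms(1) sub orbit_closed[OF assms]])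
  show "finite_gset G (gset_rest X x)"
    by (rule finite_gset_restrict[OF assms(1) Diff_subset orbit_rest_closed[OF assms]])
  have "fst X - orbit G (snd X) x \<subset> fst X"
    using orbit_self[OF assms] assms(2) by blast
  then show "card (fst (gset_rest X x)) < card (fst X)"
    using psubset_card_mono[OF gset_finite[OF assms(1)]] by (simp add: gset_restrict_def)
  have "fixed_points X K = fixed_points (gset_orbit X x) K \<union> fixed_points (gset_rest X x) K"
    "fixed_points (gset_orbit X x) K \<inter> fixed_points (gset_rest X x) K = {}"
    using sub by (auto simp: fixed_points_def gset_restrict_def)
  then show "card (fixed_points X K) =
      card (fixed_points (gset_orbit X x) K) + card (fixed_points (gset_rest X x) K)"
    using finite_fixed_points[OF assms(1), of K] by (simp add: card_Un_disjoint)
qed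

text \<open>Acting by \<open>inv h\<close> turns the equality into \<open>inv h \<otimes> g\<close>
  fixing \<open>x\<close>; points of the orbit thus correspond to left cosets of the
  stabilizer.\<close>

lemma stabilizer_eq_iff:
  assumes X: "finite_gset G X" "x \<in> fst X" and "g \<in> carrier G" "h \<in> carrier G"
  shows "snd X g x = snd X h x \<longleftrightarrow> inv h \<otimes> g \<in> stabilizer G (snd X) x"
proof -
  interpret group_action G "fst X" "snd X"
    using X(1) by (rule gset_action)
  have "snd X (inv h \<otimes> g) x = snd X (inv h) (snd X g x)"
    using assms by (simp add: gset_mult)
  moreover have "snd X h (snd X (inv h) y) = y" "snd X (inv h) (snd X h y) = y" if "y \<in> fst X" for y
    using that assms gset_mult[OF X(1), of h "inv h" y] gset_mult[OF X(1), of "inv h" h y]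
    by (simp_all add: gset_one)
  ultimately show ?thesis
    using assms gset_closed[OF X(1)] by (fastforce simp: stabilizer_def)
qed

text \<open>The assignment of \<open>g y\<close> to \<open>g x\<close> is well defined and injective
  because the two stabilizers agree.\<close>

lemma gset_iso_orbit:
  assumes X: "finite_gset G X" "x \<in> fst X" and Y: "finite_gset G Y" "y \<in> fst Y"
    and stab: "stabilizer G (snd X) x = stabilizer G (snd Y) y"
  shows "gset_iso G (gset_orbit X x) (gset_orbit Y y)"
proof -
  define f where "f z = snd Y (SOME g. g \<in> carrier G \<and> snd X g x = z) y" for z
  have f: "f (snd X g x) = snd Y g y" if g: "g \<in> carrier G" for g
  proof -
    define h where "h = (SOME h. h \<in> carrier G \<and> snd X h x = snd X g x)"
    have "h \<in> carrier G \<and> snd X h x = snd X g x"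
      unfolding h_def by (rule someI[of _ g]) (use g in simp)
    then have "snd Y h y = snd Y g y"
      using stab stabilizer_eq_iff[OF X, of h g] stabilizer_eq_iff[OF Y, of h g] g by simp
    then show ?thesis
      by (simp add: f_def h_def)
  qed
  have "inj_on f (orbit G (snd X) x)"
    using stab by (auto simp: inj_on_def orbit_def f stabilizer_eq_iff[OF X] stabilizer_eq_iff[OF Y])
  moreover have "f ` orbit G (snd X) x = orbit G (snd Y) y"
    by (force simp: orbit_def f)
  moreover have "f (snd X g z) = snd Y g (f z)" if "g \<in> carrier G" "z \<in> orbit G (snd X) x" for g z
    using that X Y by (auto simp: orbit_def f gset_mult[symmetric])
  moreover have "f z \<in> orbit G (snd Y) y" if "z \<in> orbit G (snd X) x" for z
    using that by (auto simp: orbit_def f)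
  ultimately show ?thesis
    unfolding gset_iso_def by (intro exI[of _ f]) (auto simp: gset_restrict_def bij_betw_def)
qed

lemma gset_iso_glue:
  assumes X: "finite_gset G X" "x \<in> fst X" and Y: "finite_gset G Y" "y \<in> fst Y"
    and "gset_iso G (gset_orbit X x) (gset_orbit Y y)" "gset_iso G (gset_rest X x) (gset_rest Y y)"
  shows "gset_iso G X Y"
proof -
  let ?A = "orbit G (snd X) x" and ?B = "orbit G (snd Y) y"
  obtain f where f: "bij_betw f ?A ?B"
    and f_eq: "\<And>g z. g \<in> carrier G \<Longrightarrow> z \<in> ?A \<Longrightarrow> f (snd X g z) = snd Y g (f z)"
    using assms(5) by (fastforce simp: gset_iso_def gset_restrict_def bij_betw_def)
  obtain h where h: "bij_betw h (fst X - ?A) (fst Y - ?B)"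
    and h_eq: "\<And>g z. g \<in> carrier G \<Longrightarrow> z \<in> fst X - ?A \<Longrightarrow> h (snd X g z) = snd Y g (h z)"
    using assms(6) by (fastforce simp: gset_iso_def gset_restrict_def bij_betw_def)
  let ?f = "\<lambda>z. if z \<in> ?A then f z else h z"
  have "bij_betw ?f (?A \<union> (fst X - ?A)) (?B \<union> (fst Y - ?B))"
    using bij_betw_disjoint_Un[OF f h] by auto
  then have "bij_betw ?f (fst X) (fst Y)"
    using orbit_subset[OF X] orbit_subset[OF Y] by (simp add: Un_absorb1)
  moreover have "?f (snd X g z) = snd Y g (?f z)" if "g \<in> carrier G" "z \<in> fst X" for g z
    using that f_eq h_eq orbit_closed[OF X] orbit_rest_closed[OF X] by (cases "z \<in> ?A") auto
  ultimately show ?thesis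
    unfolding gset_iso_def by blast
qed

section \<open>Marks determine a finite G-set\<close>

lemma subgroup_stabilizer: "finite_gset G X \<Longrightarrow> x \<in> fst X \<Longrightarrow> subgroup (stabilizer G (snd X) x) G"
  using group_action.stabilizer_subgroup[OF gset_action] .

lemma fixed_points_iff_stabilizer:
  "K \<subseteq> carrier G \<Longrightarrow> x \<in> fixed_points X K \<longleftrightarrow> x \<in> fst X \<and> K \<subseteq> stabilizer G (snd X) x"
  by (auto simp: fixed_points_def stabilizer_def)

text \<open>Burnside: strip off orbits with stabilizer of maximal order; a nonzero mark at such a
  stabilizer yields an isomorphic orbit in the other \<open>G\<close>-set.\<close>
theorem gset_iso_if_marks_eq:
  fixes X :: "('a, 'c) gset" and Y :: "('a, 'd) gset"
  assumes fin: "finite (carrier G)"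
    and "finite_gset G X" "finite_gset G Y"
    and "\<And>K. subgroup K G \<Longrightarrow> card (fixed_points X K) = card (fixed_points Y K)"
  shows "gset_iso G X Y"
  using assms(2-)
proof (induction "card (fst X)" arbitrary: X Y rule: less_induct)
  case less
  note X = less.prems(1) and Y = less.prems(2) and eq = less.prems(3)
  \<comment> \<open>A point is fixed by its own stabilizer, so the mark of \<open>Z\<close> there is
    nonzero; equal marks give a point of \<open>Z'\<close> with at least that stabilizer. Two
    arbitrary G-sets are taken because the claim is applied in both directions.\<close>
  have transfer: "\<exists>z\<in>fst Z'. stabilizer G (snd Z) z0 \<subseteq> stabilizer G (snd Z') z"
    if Z: "finite_gset G Z" "z0 \<in> fst Z" and Z': "finite_gset G Z'"
      and "\<And>K. subgroup K G \<Longrightarrow> card (fixed_points Z K) = card (fixed_points Z' K)"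
    for Z :: "('a, 'e) gset" and Z' :: "('a, 'f) gset" and z0
  proof -
    let ?K = "stabilizer G (snd Z) z0"
    have K: "subgroup ?K G"
      using Z by (rule subgroup_stabilizer)
    then have sub: "?K \<subseteq> carrier G"
      by (rule subgroup.subset)
    have "z0 \<in> fixed_points Z ?K"
      using Z sub by (simp add: fixed_points_iff_stabilizer)
    then have "card (fixed_points Z' ?K) \<noteq> 0"
      using finite_fixed_points[OF Z(1), of ?K] that(4)[OF K] by (metis card_eq_0_iff empty_iff)
    then obtain z where "z \<in> fixed_points Z' ?K"
      by fastforce
    then show ?thesis
      using sub by (auto simp: fixed_points_iff_stabilizer)
  qed
  show ?case
  proof (cases "fst X = {}")
    case True
    then have "fst Y = {}"
      using transfer[OF Y _ X] eq by fastforce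
    then show ?thesis
      using True by (simp add: gset_iso_def bij_betw_def)
  next
    case False
    define m where "m = Max ((\<lambda>x. card (stabilizer G (snd X) x)) ` fst X)"
    have "m \<in> (\<lambda>x. card (stabilizer G (snd X) x)) ` fst X"
      unfolding m_def using False gset_finite[OF X] by (intro Max_in) auto
    then obtain x where x: "x \<in> fst X" "card (stabilizer G (snd X) x) = m"
      by auto
    have max: "card (stabilizer G (snd X) z) \<le> m" if "z \<in> fst X" for z
      unfolding m_def using that gset_finite[OF X] by (intro Max_ge) auto
    obtain y where y: "y \<in> fst Y" "stabilizer G (snd X) x \<subseteq> stabilizer G (snd Y) y"
      using transfer[OF X x(1) Y] eq by blast
    obtain z where z: "z \<in> fst X" "stabilizer G (snd Y) y \<subseteq> stabilizer G (snd X) z"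
      using transfer[OF Y y(1) X] eq[symmetric] by blast
    have "finite (stabilizer G (snd X) z)" "finite (stabilizer G (snd Y) y)"
      using finite_subset[OF _ fin] by (auto simp: stabilizer_def)
    \<comment> \<open>The stabilizers of \<open>x\<close>, \<open>y\<close>, \<open>z\<close> form
      an ascending chain, and that of \<open>x\<close> already has the maximal order
      \<open>m\<close>, so the chain is constant.\<close>
    then have stab: "stabilizer G (snd X) x = stabilizer G (snd Y) y"
      using card_mono[OF _ z(2)] max[OF z(1)] x(2) y(2) by (intro card_seteq) auto
    have orb: "gset_iso G (gset_orbit X x) (gset_orbit Y y)"
      by (rule gset_iso_orbit[OF X x(1) Y y(1) stab])
    have "gset_iso G (gset_rest X x) (gset_rest Y y)"
    proof (rule less.hyps)
      show "card (fst (gset_rest X x)) < card (fst X)"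
        by (rule card_gset_rest[OF X x(1)])
      show "finite_gset G (gset_rest X x)" "finite_gset G (gset_rest Y y)"
        by (rule finite_gset_rest[OF X x(1)], rule finite_gset_rest[OF Y y(1)])
      show "card (fixed_points (gset_rest X x) K) = card (fixed_points (gset_rest Y y) K)"
        if K: "subgroup K G" for K
        using eq[OF K] gset_iso_card_fixed_points[OF orb finite_gset_orbit[OF X x(1)]
            subgroup.subset[OF K]]
        by (simp add: card_fixed_points_orbit_rest[OF X x(1)] card_fixed_points_orbit_rest[OF Y y(1)])
    qed
    with orb show ?thesis
      by (rule gset_iso_glue[OF X x(1) Y y(1)])
  qed
qed

end

section \<open>The Burnside ring\<close>

locale finite_group = group +
  assumes finite_carrier: "finite (carrier G)"
begin

section \<open>Formal differences and their marks\<close>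

abbreviation B :: "'a virtual_gset ring" where
  "B \<equiv> burnside_ring G"

abbreviation nfix :: "('a, 'c) gset \<Rightarrow> 'a set \<Rightarrow> int" where
  "nfix X K \<equiv> int (card (fixed_points X K))"

text \<open>By Burnside's theorem equal marks force an isomorphism, so the summand \<open>Z\<close>
  can be eliminated and membership becomes a condition on integers.\<close>

lemma gset_diff_eq:
  assumes S: "finite_gset G S" and T: "finite_gset G T"
  shows "gset_diff G S T = {(X, Y). finite_gset G X \<and> finite_gset G Y \<and>
    (\<forall>K. subgroup K G \<longrightarrow> nfix X K - nfix Y K = nfix S K - nfix T K)}"
proof -
  have "(\<exists>Z :: ('a, nat) gset. finite_gset G Z \<and>
      gset_iso G (gset_sum (gset_sum S Y) Z) (gset_sum (gset_sum X T) Z)) \<longleftrightarrow>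
    (\<forall>K. subgroup K G \<longrightarrow> nfix X K - nfix Y K = nfix S K - nfix T K)" (is "?L \<longleftrightarrow> ?R")
    if X: "finite_gset G X" and Y: "finite_gset G Y" for X Y :: "('a, nat) gset"
  proof
    assume ?L
    then obtain Z :: "('a, nat) gset" where Z: "finite_gset G Z"
      and iso: "gset_iso G (gset_sum (gset_sum S Y) Z) (gset_sum (gset_sum X T) Z)"
      by blast
    have "nfix S K + nfix Y K + nfix Z K = nfix X K + nfix T K + nfix Z K" if "subgroup K G" for K
      using gset_iso_card_fixed_points[OF iso _ subgroup.subset[OF that]] S T X Y Z
      by (simp add: finite_gset_sum card_fixed_points_sum flip: of_nat_add)
    then show ?R
      by (auto simp: algebra_simps)
  next
    assume R: ?R
    \<comment> \<open>Equal marks give an isomorphism outright, so the empty G-set serves as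
      \<open>Z\<close>.\<close>
    have "gset_iso G (gset_sum (gset_sum S Y) (gset_empty :: ('a, nat) gset))
      (gset_sum (gset_sum X T) (gset_empty :: ('a, nat) gset))"
    proof (rule gset_iso_if_marks_eq[OF finite_carrier])
      fix K assume "subgroup K G"
      then have "nfix S K + nfix Y K = nfix X K + nfix T K"
        using R by (auto simp: algebra_simps)
      then show "card (fixed_points (gset_sum (gset_sum S Y) (gset_empty :: ('a, nat) gset)) K) =
        card (fixed_points (gset_sum (gset_sum X T) (gset_empty :: ('a, nat) gset)) K)"
        using S T X Y by (simp add: finite_gset_sum card_fixed_points_sum finite_gset_empty
            card_fixed_points_empty)
    qed (use S T X Y in \<open>auto intro!: finite_gset_sum finite_gset_empty\<close>)
    then show ?L
      using finite_gset_empty by blast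
  qed
  then show ?thesis
    unfolding gset_diff_def by blast
qed

lemma mem_gset_diff_self:
  "finite_gset G S \<Longrightarrow> finite_gset G T \<Longrightarrow> (S, T) \<in> gset_diff G S T"
  by (simp add: gset_diff_eq)

text \<open>The members of a class live on naturals while \<open>S\<close> and \<open>T\<close> need
  not; transporting both gives representatives of the right type and shows that the class is
  nonempty.\<close>

lemma ex_mem_gset_diff:
  assumes "finite_gset G S" "finite_gset G T"
  obtains S' T' :: "('a, nat) gset" where "finite_gset G S'" "finite_gset G T'"
    "(S', T') \<in> gset_diff G S T" "gset_diff G S T = gset_diff G S' T'"
proof -
  obtain S' :: "('a, nat) gset" where S': "finite_gset G S'" "gset_iso G S' S"
    using ex_nat_gset[OF assms(1)] .
  obtain T' :: "('a, nat) gset" where T': "finite_gset G T'" "gset_iso G T' T"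
    using ex_nat_gset[OF assms(2)] .
  have eq: "card (fixed_points S' K) = card (fixed_points S K)"
    "card (fixed_points T' K) = card (fixed_points T K)" if "subgroup K G" for K
    using gset_iso_card_fixed_points[OF S'(2) S'(1)] gset_iso_card_fixed_points[OF T'(2) T'(1)]
      subgroup.subset[OF that] by auto
  show ?thesis
    using S'(1) T'(1) by (rule that) (auto simp: gset_diff_eq assms S'(1) T'(1) eq)
qed

text \<open>All representatives give the same difference and the class is nonempty, so
  \<open>the_elem\<close> in \<open>mark\<close> is applied to a singleton.\<close>

lemma mark_gset_diff:
  assumes "finite_gset G S" "finite_gset G T" "subgroup K G"
  shows "mark G K (gset_diff G S T) = nfix S K - nfix T K"
proof -
  have eq: "nfix X K - nfix Y K = nfix S K - nfix T K" if "(X, Y) \<in> gset_diff G S T" for X Y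
    using that assms by (simp add: gset_diff_eq)
  have "gset_diff G S T \<noteq> {}"
    using ex_mem_gset_diff[OF assms(1,2)] by blast
  then have "(\<lambda>(X, Y). nfix X K - nfix Y K) ` gset_diff G S T =
      (\<lambda>_. nfix S K - nfix T K) ` gset_diff G S T"
    by (intro image_cong) (auto simp: eq)
  with \<open>gset_diff G S T \<noteq> {}\<close> have "(\<lambda>(X, Y). nfix X K - nfix Y K) ` gset_diff G S T = {nfix S K - nfix T K}"
    by auto
  then show ?thesis
    by (simp add: mark_def)
qed

lemma mark_gset_class:
  "finite_gset G S \<Longrightarrow> subgroup K G \<Longrightarrow> mark G K (gset_class G S) = nfix S K"
  by (simp add: gset_class_def mark_gset_diff finite_gset_empty card_fixed_points_empty)

lemma gset_diff_in_carrier: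
  assumes "finite_gset G S" "finite_gset G T"
  shows "gset_diff G S T \<in> carrier B"
  using ex_mem_gset_diff[OF assms] unfolding burnside_ring_def
  by (simp del: split_paired_Ex) metis

lemma gset_class_in_carrier: "finite_gset G S \<Longrightarrow> gset_class G S \<in> carrier B"
  by (simp add: gset_class_def gset_diff_in_carrier finite_gset_empty)

lemma burnside_carrierE:
  assumes "u \<in> carrier B"
  obtains S T :: "('a, nat) gset" where "finite_gset G S" "finite_gset G T" "u = gset_diff G S T"
  using assms by (auto simp: burnside_ring_def)

text \<open>Membership in a class is decided by marks alone (\<open>gset_diff_eq\<close>). This
  injectivity of the marks is how equations in the ring are proved below.\<close>

lemma burnside_eqI:
  assumes "u \<in> carrier B" "v \<in> carrier B" "\<And>K. subgroup K G \<Longrightarrow> mark G K u = mark G K v"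
  shows "u = v"
proof -
  obtain S T S' T' :: "('a, nat) gset" where *: "finite_gset G S" "finite_gset G T"
    "finite_gset G S'" "finite_gset G T'" "u = gset_diff G S T" "v = gset_diff G S' T'"
    using assms by (metis burnside_carrierE)
  have "nfix S K - nfix T K = nfix S' K - nfix T' K" if "subgroup K G" for K
    using assms(3)[OF that] * that by (simp add: mark_gset_diff)
  then show ?thesis
    using * by (auto simp: gset_diff_eq)
qed

lemma fix_eq_mark:
  assumes "u \<in> carrier B" "(X, Y) \<in> u" "subgroup K G"
  shows "nfix X K - nfix Y K = mark G K u"
  using assms(1)
proof (rule burnside_carrierE)
  fix S T :: "('a, nat) gset"
  assume *: "finite_gset G S" "finite_gset G T" "u = gset_diff G S T"
  then have "mark G K u = nfix S K - nfix T K"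
    using assms(3) by (simp add: mark_gset_diff)
  then show ?thesis
    using assms(2,3) * by (simp add: gset_diff_eq)
qed

section \<open>Marks of sums, products and differences\<close>

lemma burnside_memD:
  assumes "u \<in> carrier B" "(X, Y) \<in> u"
  shows "finite_gset G X" "finite_gset G Y"
  using assms by (auto elim!: burnside_carrierE simp: gset_diff_eq)

lemma burnside_nonempty:
  assumes "u \<in> carrier B"
  obtains X Y where "(X, Y) \<in> u"
  using assms mem_gset_diff_self by (metis burnside_carrierE)

text \<open>The ring operations are unions over all pairs of representatives. Since the marks of the
  result, given by \<open>m\<close>, are the same for every pair, each pair contributes the same
  class, and the union is that class.\<close>

lemma burnside_UN_eq:
  assumes u: "u \<in> carrier B" and v: "v \<in> carrier B"
    and fin: "\<And>S T S' T'. finite_gset G S \<Longrightarrow> finite_gset G T \<Longrightarrow> finite_gset G S' \<Longrightarrow>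
      finite_gset G T' \<Longrightarrow> finite_gset G (p S T S' T') \<and> finite_gset G (q S T S' T')"
    and eq: "\<And>S T S' T' K. (S, T) \<in> u \<Longrightarrow> (S', T') \<in> v \<Longrightarrow> subgroup K G \<Longrightarrow>
      nfix (p S T S' T') K - nfix (q S T S' T') K = m K"
  shows "(\<Union>(S, T)\<in>u. \<Union>(S', T')\<in>v. gset_diff G (p S T S' T') (q S T S' T')) \<in> carrier B"
    (is "?w \<in> _")
    and "subgroup K G \<Longrightarrow>
      mark G K (\<Union>(S, T)\<in>u. \<Union>(S', T')\<in>v. gset_diff G (p S T S' T') (q S T S' T')) = m K"
proof -
  obtain S T where ST: "(S, T) \<in> u"
    using u by (rule burnside_nonempty)
  obtain S' T' where ST': "(S', T') \<in> v"
    using v by (rule burnside_nonempty)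
  have fin': "finite_gset G (p S T S' T')" "finite_gset G (q S T S' T')"
    if "(S, T) \<in> u" "(S', T') \<in> v" for S T S' T'
    using fin burnside_memD[OF u that(1)] burnside_memD[OF v that(2)] by auto
  define W where "W = gset_diff G (p S T S' T') (q S T S' T')"
  have W: "W \<in> carrier B" "\<And>K. subgroup K G \<Longrightarrow> mark G K W = m K"
    unfolding W_def using fin'[OF ST ST'] eq[OF ST ST']
    by (simp_all add: gset_diff_in_carrier mark_gset_diff)
  have W_eq: "gset_diff G (p S1 T1 S1' T1') (q S1 T1 S1' T1') = W"
    if "(S1, T1) \<in> u" "(S1', T1') \<in> v" for S1 T1 S1' T1'
    using fin'[OF that] eq[OF that] W
    by (intro burnside_eqI) (simp_all add: gset_diff_in_carrier mark_gset_diff)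
  have "?w = W"
  proof (rule equalityI)
    show "?w \<subseteq> W"
      using W_eq by blast
    show "W \<subseteq> ?w"
      unfolding W_def using ST ST' by blast
  qed
  then show "?w \<in> carrier B" "subgroup K G \<Longrightarrow> mark G K ?w = m K"
    using W by simp_all
qed

lemma
  assumes u: "u \<in> carrier B" and v: "v \<in> carrier B"
  shows burnside_add_closed: "u \<oplus>\<^bsub>B\<^esub> v \<in> carrier B"
    and mark_add: "subgroup K G \<Longrightarrow> mark G K (u \<oplus>\<^bsub>B\<^esub> v) = mark G K u + mark G K v"
proof -
  have add: "u \<oplus>\<^bsub>B\<^esub> v =
      (\<Union>(S, T)\<in>u. \<Union>(S', T')\<in>v. gset_diff G (gset_sum S S') (gset_sum T T'))"
    by (simp add: burnside_ring_def)
  have eq: "nfix (gset_sum S S') K - nfix (gset_sum T T') K = mark G K u + mark G K v"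
    if "(S, T) \<in> u" "(S', T') \<in> v" "subgroup K G" for S T S' T' K
    using burnside_memD[OF u that(1)] burnside_memD[OF v that(2)]
      fix_eq_mark[OF u that(1,3)] fix_eq_mark[OF v that(2,3)]
    by (simp add: card_fixed_points_sum)
  show "u \<oplus>\<^bsub>B\<^esub> v \<in> carrier B"
    unfolding add by (rule burnside_UN_eq(1)[OF u v _ eq]) (auto intro: finite_gset_sum)
  show "subgroup K G \<Longrightarrow> mark G K (u \<oplus>\<^bsub>B\<^esub> v) = mark G K u + mark G K v"
    unfolding add by (rule burnside_UN_eq(2)[OF u v _ eq]) (auto intro: finite_gset_sum)
qed

lemma mark_mult:
  assumes u: "u \<in> carrier B" and v: "v \<in> carrier B" and K: "subgroup K G"
  shows "mark G K (u \<otimes>\<^bsub>B\<^esub> v) = mark G K u * mark G K v"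
proof -
  have mult: "u \<otimes>\<^bsub>B\<^esub> v =
      (\<Union>(S, T)\<in>u. \<Union>(S', T')\<in>v. gset_diff G (gset_sum (gset_prod S S') (gset_prod T T'))
        (gset_sum (gset_prod S T') (gset_prod T S')))"
    by (simp add: burnside_ring_def)
  \<comment> \<open>This is (s - t)(s' - t') = (ss' + tt') - (st' + ts') for the fixed-point
    counts.\<close>
  have eq: "nfix (gset_sum (gset_prod S S') (gset_prod T T')) K -
      nfix (gset_sum (gset_prod S T') (gset_prod T S')) K = mark G K u * mark G K v"
    if "(S, T) \<in> u" "(S', T') \<in> v" "subgroup K G" for S T S' T' K
    using burnside_memD[OF u that(1)] burnside_memD[OF v that(2)]
    by (simp add: card_fixed_points_sum card_fixed_points_prod finite_gset_prod
        fix_eq_mark[OF u that(1,3), symmetric] fix_eq_mark[OF v that(2,3), symmetric] algebra_simps)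
  show ?thesis
    unfolding mult
    by (rule burnside_UN_eq(2)[OF u v _ eq K]) (auto intro: finite_gset_sum finite_gset_prod)
qed

text \<open>The witness is \<open>S + T'\<close> minus \<open>T + S'\<close>. Describing the
  difference through its marks suffices, since marks determine elements of the ring.\<close>

lemma ex_burnside_diff:
  assumes u: "u \<in> carrier B" and v: "v \<in> carrier B"
  obtains w where "w \<in> carrier B" "\<And>K. subgroup K G \<Longrightarrow> mark G K w = mark G K u - mark G K v"
proof -
  obtain S T S' T' :: "('a, nat) gset" where *: "finite_gset G S" "finite_gset G T"
    "finite_gset G S'" "finite_gset G T'" "u = gset_diff G S T" "v = gset_diff G S' T'"
    using assms by (metis burnside_carrierE)
  show ?thesis
    by (rule that[of "gset_diff G (gset_sum S T') (gset_sum T S')"])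
      (auto simp: * gset_diff_in_carrier finite_gset_sum mark_gset_diff card_fixed_points_sum)
qed

section \<open>Coset spaces as additive generators of the ring\<close>

lemma mult_inv_cancel: "g \<in> carrier G \<Longrightarrow> x \<in> carrier G \<Longrightarrow> g \<otimes> (inv g \<otimes> x) = x"
  by (simp flip: m_assoc)

lemma l_coset_eq_iff:
  assumes "subgroup H G" "a \<in> carrier G" "b \<in> carrier G"
  shows "a <# H = b <# H \<longleftrightarrow> inv b \<otimes> a \<in> H"
proof -
  interpret H: subgroup H G by fact
  have "a <# H = b <# H \<longleftrightarrow> a \<in> b <# H"
    using assms lcos_self l_repr_independence by blast
  then show ?thesis
    using assms H.lcos_module_imp[OF is_group] H.lcos_module_rev[OF is_group] by blast
qed

lemma fst_coset_gset: "fst (coset_gset G H) = (\<lambda>a. a <# H) ` carrier G"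
  by (auto simp: coset_gset_def LCOSETS_def)

lemma snd_coset_gset:
  assumes "subgroup H G" "g \<in> carrier G" "a \<in> carrier G"
  shows "snd (coset_gset G H) g (a <# H) = (g \<otimes> a) <# H"
proof -
  have "a <# H \<in> lcosets H"
    using assms(3) by (auto simp: LCOSETS_def)
  then show ?thesis
    using assms by (simp add: coset_gset_def lcos_m_assoc subgroup.subset)
qed

lemma finite_gset_coset:
  assumes "subgroup H G"
  shows "finite_gset G (coset_gset G H)"
proof -
  have *: "lcosets H = (\<lambda>a. a <# H) ` carrier G"
    by (auto simp: LCOSETS_def)
  note sub = subgroup.subset[OF assms]
  show ?thesis
    unfolding coset_gset_def
  proof (rule finite_gsetI)
    show "finite (lcosets H)"
      using finite_carrier by (simp add: *)
  qed (use sub in \<open>auto simp: * lcos_m_assoc m_assoc\<close>)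
qed

text \<open>The right-hand side is the conjugate \<open>a H a^-1\<close>.\<close>

lemma stabilizer_coset_gset:
  assumes H: "subgroup H G" and a: "a \<in> carrier G"
  shows "stabilizer G (snd (coset_gset G H)) (a <# H) = {g \<in> carrier G. inv a \<otimes> g \<otimes> a \<in> H}"
proof -
  have "snd (coset_gset G H) g (a <# H) = a <# H \<longleftrightarrow> inv a \<otimes> g \<otimes> a \<in> H" if "g \<in> carrier G" for g
    using l_coset_eq_iff[OF H, of "g \<otimes> a" a] that a by (simp add: snd_coset_gset[OF H] m_assoc)
  then show ?thesis
    by (auto simp: stabilizer_def)
qed

lemma subgroup_in_coset_gset: "subgroup H G \<Longrightarrow> H \<in> fst (coset_gset G H)"
  using lcos_mult_one[OF subgroup.subset] by (auto simp: fst_coset_gset intro!: rev_image_eqI[of \<one>])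

lemma stabilizer_coset_gset_self:
  assumes "subgroup H G"
  shows "stabilizer G (snd (coset_gset G H)) H = H"
  using stabilizer_coset_gset[OF assms, of \<one>] subgroup.subset[OF assms]
  by (auto simp: lcos_mult_one)

lemma orbit_coset_gset_self:
  assumes "subgroup H G"
  shows "orbit G (snd (coset_gset G H)) H = fst (coset_gset G H)"
proof -
  have "snd (coset_gset G H) g H = g <# H" if "g \<in> carrier G" for g
    using snd_coset_gset[OF assms that, of \<one>] subgroup.subset[OF assms] that
    by (simp add: lcos_mult_one)
  then show ?thesis
    by (auto simp: orbit_def fst_coset_gset)
qed

text \<open>Orbit-stabilizer for G-sets: the coset \<open>H\<close> has stabilizer \<open>H\<close>
  and its orbit is all of \<open>G/H\<close>, so \<open>gset_iso_orbit\<close> identifies the orbit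
  of \<open>x\<close> with the coset space.\<close>

lemma card_fixed_points_orbit:
  assumes X: "finite_gset G X" "x \<in> fst X" and K: "subgroup K G"
  shows "card (fixed_points (gset_orbit X x) K) =
    card (fixed_points (coset_gset G (stabilizer G (snd X) x)) K)"
proof -
  let ?H = "stabilizer G (snd X) x"
  have H: "subgroup ?H G"
    using X by (rule subgroup_stabilizer)
  have "gset_iso G (gset_orbit X x) (gset_orbit (coset_gset G ?H) ?H)"
    by (rule gset_iso_orbit[OF X finite_gset_coset[OF H] subgroup_in_coset_gset[OF H]])
      (simp add: stabilizer_coset_gset_self[OF H])
  then have "card (fixed_points (gset_orbit X x) K) =
      card (fixed_points (gset_orbit (coset_gset G ?H) ?H) K)"
    by (rule gset_iso_card_fixed_points[OF _ finite_gset_orbit[OF X] subgroup.subset[OF K]])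
  also have "fixed_points (gset_orbit (coset_gset G ?H) ?H) K = fixed_points (coset_gset G ?H) K"
    using subgroup.subset[OF K]
    by (auto simp: fixed_points_def gset_restrict_def orbit_coset_gset_self[OF H])
  finally show ?thesis .
qed

text \<open>Every finite G-set is a sum of orbits, so the classes \<open>[G/H]\<close> generate the
  additive group. Negatives are reached by the case \<open>diff\<close>, which cancels a
  summand.\<close>

lemma burnside_induct [consumes 1, case_names coset add diff]:
  assumes u: "u \<in> carrier B"
    and coset: "\<And>H. subgroup H G \<Longrightarrow> Q (gset_class G (coset_gset G H))"
    and add: "\<And>u v. u \<in> carrier B \<Longrightarrow> v \<in> carrier B \<Longrightarrow> Q u \<Longrightarrow> Q v \<Longrightarrow> Q (u \<oplus>\<^bsub>B\<^esub> v)"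
    and diff: "\<And>u v. u \<in> carrier B \<Longrightarrow> v \<in> carrier B \<Longrightarrow> Q (u \<oplus>\<^bsub>B\<^esub> v) \<Longrightarrow> Q v \<Longrightarrow> Q u"
  shows "Q u"
proof -
  have eff: "Q (gset_class G S)" if "finite_gset G S" for S :: "('a, nat) gset"
    using that
  proof (induction "card (fst S)" arbitrary: S rule: less_induct)
    case less
    note S = less.prems
    show ?case
    proof (cases "fst S = {}")
      case True
      \<comment> \<open>The zero class is obtained by cancelling \<open>[G/G]\<close> from
        \<open>0 + [G/G] = [G/G]\<close>.\<close>
      let ?c = "gset_class G (coset_gset G (carrier G))"
      have c: "?c \<in> carrier B" "Q ?c"
        by (auto intro: gset_class_in_carrier finite_gset_coset subgroup_self coset)
      have "gset_class G S \<oplus>\<^bsub>B\<^esub> ?c = ?c"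
        using True c S
        by (intro burnside_eqI burnside_add_closed gset_class_in_carrier)
          (simp_all add: mark_add gset_class_in_carrier mark_gset_class fixed_points_def
            finite_gset_coset subgroup_self)
      then show ?thesis
        using diff[OF gset_class_in_carrier[OF S] c(1)] c(2) by simp
    next
      case False
      then obtain x where x: "x \<in> fst S"
        by blast
      let ?H = "stabilizer G (snd S) x"
      have H: "subgroup ?H G"
        using S x by (rule subgroup_stabilizer)
      note rest = finite_gset_rest[OF S x]
      have "gset_class G S = gset_class G (coset_gset G ?H) \<oplus>\<^bsub>B\<^esub> gset_class G (gset_rest S x)"
        by (rule burnside_eqI)
          (simp_all add: S H rest burnside_add_closed gset_class_in_carrier finite_gset_coset mark_add
            mark_gset_class card_fixed_points_orbit_rest[OF S x] card_fixed_points_orbit[OF S x])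
      moreover have "Q (gset_class G (gset_rest S x))"
        by (rule less.hyps[OF card_gset_rest[OF S x] rest])
      ultimately show ?thesis
        using add coset[OF H] by (simp add: gset_class_in_carrier finite_gset_coset H rest)
    qed
  qed
  obtain S T :: "('a, nat) gset" where ST: "finite_gset G S" "finite_gset G T" "u = gset_diff G S T"
    using u by (rule burnside_carrierE)
  have "u \<oplus>\<^bsub>B\<^esub> gset_class G T = gset_class G S"
    using u ST
    by (intro burnside_eqI burnside_add_closed gset_class_in_carrier)
      (simp_all add: mark_add gset_class_in_carrier mark_gset_class mark_gset_diff)
  then show ?thesis
    using diff[OF u gset_class_in_carrier[OF ST(2)]] eff ST by simp
qed

section \<open>Conjugation and normal cores\<close>

lemma mem_normal_core:
  assumes "subgroup H G"
  shows "x \<in> normal_core G H \<longleftrightarrow> x \<in> carrier G \<and> (\<forall>g\<in>carrier G. inv g \<otimes> x \<otimes> g \<in> H)"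
proof -
  note sub = subgroup.subset[OF assms]
  have "x \<in> g <# H #> inv g \<longleftrightarrow> x \<in> carrier G \<and> inv g \<otimes> x \<otimes> g \<in> H" if g: "g \<in> carrier G" for g
  proof
    assume "x \<in> g <# H #> inv g"
    then obtain h where "h \<in> H" "x = g \<otimes> h \<otimes> inv g"
      by (auto simp: l_coset_def r_coset_def)
    moreover from this have "inv g \<otimes> x \<otimes> g = h"
      using g sub by (auto simp: m_assoc inv_solve_left inv_solve_left')
    ultimately show "x \<in> carrier G \<and> inv g \<otimes> x \<otimes> g \<in> H"
      using g sub by auto
  next
    assume *: "x \<in> carrier G \<and> inv g \<otimes> x \<otimes> g \<in> H"
    then have "x = g \<otimes> (inv g \<otimes> x \<otimes> g) \<otimes> inv g"
      using g by (simp add: m_assoc mult_inv_cancel)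
    then show "x \<in> g <# H #> inv g"
      using * by (auto simp: l_coset_def r_coset_def)
  qed
  \<comment> \<open>\<open>one_closed\<close> makes the index set of the intersection nonempty,
    which is why members of the core lie in \<open>carrier G\<close>.\<close>
  then show ?thesis
    using one_closed unfolding normal_core_def by blast
qed

lemma normal_normal_core:
  assumes "subgroup H G"
  shows "normal_core G H \<lhd> G"
proof -
  have "subgroup (normal_core G H) G"
  proof (rule subgroupI)
    show "normal_core G H \<subseteq> carrier G"
      using assms by (auto simp: mem_normal_core)
    have "\<one> \<in> normal_core G H"
      using assms by (simp add: mem_normal_core subgroup.one_closed)
    then show "normal_core G H \<noteq> {}"
      by blast
  next
    fix x assume "x \<in> normal_core G H"
    then have x: "x \<in> carrier G" "\<And>g. g \<in> carrier G \<Longrightarrow> inv g \<otimes> x \<otimes> g \<in> H"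
      using assms by (auto simp: mem_normal_core)
    have "inv g \<otimes> inv x \<otimes> g \<in> H" if "g \<in> carrier G" for g
      using subgroup.m_inv_closed[OF assms x(2)[OF that]] x(1) that
      by (simp add: inv_mult_group m_assoc)
    then show "inv x \<in> normal_core G H"
      using assms x by (simp add: mem_normal_core)
  next
    fix x y assume "x \<in> normal_core G H" "y \<in> normal_core G H"
    then have xy: "x \<in> carrier G" "y \<in> carrier G"
      and *: "\<And>g. g \<in> carrier G \<Longrightarrow> inv g \<otimes> x \<otimes> g \<in> H" "\<And>g. g \<in> carrier G \<Longrightarrow> inv g \<otimes> y \<otimes> g \<in> H"
      using assms by (auto simp: mem_normal_core)
    have "inv g \<otimes> (x \<otimes> y) \<otimes> g \<in> H" if g: "g \<in> carrier G" for g
    proof -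
      have "(inv g \<otimes> x \<otimes> g) \<otimes> (inv g \<otimes> y \<otimes> g) = inv g \<otimes> (x \<otimes> y) \<otimes> g"
        using g xy by (metis inv_closed inv_solve_right' l_inv m_assoc m_closed r_inv r_one)
      then show ?thesis
        using subgroup.m_closed[OF assms *(1)[OF g] *(2)[OF g]] by simp
    qed
    then show "x \<otimes> y \<in> normal_core G H"
      using assms xy by (simp add: mem_normal_core)
  qed
  moreover have "g \<otimes> x \<otimes> inv g \<in> normal_core G H"
    if g: "g \<in> carrier G" and x: "x \<in> normal_core G H" for g x
  proof -
    have "inv h \<otimes> (g \<otimes> x \<otimes> inv g) \<otimes> h \<in> H" if h: "h \<in> carrier G" for h
    proof -
      have "inv (inv g \<otimes> h) \<otimes> x \<otimes> (inv g \<otimes> h) \<in> H"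
        using x g h assms by (simp add: mem_normal_core)
      then show ?thesis
        using x g h assms by (simp add: mem_normal_core inv_mult_group m_assoc)
    qed
    then show ?thesis
      using x g assms by (simp add: mem_normal_core)
  qed
  ultimately show ?thesis
    by (simp add: normal_inv_iff)
qed

lemma normal_core_subset:
  assumes "subgroup H G"
  shows "normal_core G H \<subseteq> H"
proof
  fix x assume "x \<in> normal_core G H"
  then have "x \<in> carrier G" "inv \<one> \<otimes> x \<otimes> \<one> \<in> H"
    using assms one_closed unfolding mem_normal_core[OF assms] by blast+
  then show "x \<in> H" by simp
qed

lemma normal_conj_mem:
  assumes "N \<lhd> G" "g \<in> carrier G" "x \<in> N"
  shows "inv g \<otimes> x \<otimes> g \<in> N"
  using assms normal.inv_op_closed1 by fast

lemma normal_conj_mem_iff: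
  assumes N: "N \<lhd> G" and g: "g \<in> carrier G" "x \<in> carrier G"
  shows "inv g \<otimes> x \<otimes> g \<in> N \<longleftrightarrow> x \<in> N"
proof
  assume "inv g \<otimes> x \<otimes> g \<in> N"
  then have "g \<otimes> (inv g \<otimes> x \<otimes> g) \<otimes> inv g \<in> N"
    using N g(1) by (meson normal.inv_op_closed2)
  then show "x \<in> N"
    using g by (simp add: m_assoc mult_inv_cancel)
qed (use assms normal_conj_mem in blast)

text \<open>Conjugates of elements of \<open>N\<close> stay in \<open>N\<close>, hence in
  \<open>H\<close>, so the core is the largest normal subgroup of \<open>G\<close> inside
  \<open>H\<close>. This is why compression leaves \<open>mark_sum\<close> unchanged.\<close>

lemma subset_normal_core_iff:
  assumes N: "N \<lhd> G" and H: "subgroup H G"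
  shows "N \<subseteq> normal_core G H \<longleftrightarrow> N \<subseteq> H"
proof
  assume "N \<subseteq> H"
  then show "N \<subseteq> normal_core G H"
    using normal_conj_mem[OF N] subgroup.subset[OF normal_imp_subgroup[OF N]]
    unfolding subset_iff mem_normal_core[OF H] by blast
qed (use normal_core_subset[OF H] in blast)

end

section \<open>The core compression\<close>

definition normal_closure :: "('a, 'm) monoid_scheme \<Rightarrow> 'a set \<Rightarrow> 'a set" where
  "normal_closure G K = \<Inter>{N. N \<lhd> G \<and> K \<subseteq> N}"

context finite_group
begin

section \<open>Normal closures, fixed points and orbit counts\<close>

lemma normal_normal_closure:
  assumes "K \<subseteq> carrier G"
  shows "normal_closure G K \<lhd> G"
  unfolding normal_inv_iff
proof
  have "carrier G \<in> {N. N \<lhd> G \<and> K \<subseteq> N}"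
    using normal_self assms by simp
  then show "subgroup (normal_closure G K) G"
    unfolding normal_closure_def by (intro subgroups_Inter) (auto intro: normal_imp_subgroup)
  show "\<forall>x\<in>carrier G. \<forall>h\<in>normal_closure G K. x \<otimes> h \<otimes> inv x \<in> normal_closure G K"
    by (auto simp: normal_closure_def normal_inv_iff)
qed

lemma subset_normal_closure: "K \<subseteq> normal_closure G K"
  by (auto simp: normal_closure_def)

lemma normal_closure_subset_iff: "N \<lhd> G \<Longrightarrow> normal_closure G K \<subseteq> N \<longleftrightarrow> K \<subseteq> N"
  by (auto simp: normal_closure_def)

text \<open>Every coset of a normal \<open>N\<close> has stabilizer \<open>N\<close>, so
  \<open>K\<close> fixes all of them or none. Hence the mark of \<open>[G/N]\<close> at
  \<open>K\<close> sees only the normal closure of \<open>K\<close>.\<close>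

lemma fixed_points_coset_gset_normal:
  assumes N: "N \<lhd> G" and K: "K \<subseteq> carrier G"
  shows "fixed_points (coset_gset G N) K = (if K \<subseteq> N then fst (coset_gset G N) else {})"
proof -
  have "C \<in> fixed_points (coset_gset G N) K \<longleftrightarrow> K \<subseteq> N" if C: "C \<in> fst (coset_gset G N)" for C
  proof -
    obtain a where a: "a \<in> carrier G" "C = a <# N"
      using C by (auto simp: fst_coset_gset)
    have "stabilizer G (snd (coset_gset G N)) C = {g \<in> carrier G. g \<in> N}"
      using a(1) N normal_conj_mem_iff[OF N] unfolding a(2)
      by (subst stabilizer_coset_gset) (auto simp: normal_imp_subgroup)
    then show ?thesis
      using C K by (auto simp: fixed_points_iff_stabilizer)
  qed
  moreover have "fixed_points (coset_gset G N) K \<subseteq> fst (coset_gset G N)"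
    by (auto simp: fixed_points_def)
  ultimately show ?thesis
    by auto
qed

text \<open>Stabilizers of cosets are conjugates of \<open>H\<close>, and a normal \<open>N\<close>
  lies in one of them exactly when it lies in \<open>H\<close>.\<close>

lemma fixed_points_coset_gset_of_normal:
  assumes N: "N \<lhd> G" and H: "subgroup H G"
  shows "fixed_points (coset_gset G H) N = (if N \<subseteq> H then fst (coset_gset G H) else {})"
proof -
  note NG = subgroup.subset[OF normal_imp_subgroup[OF N]]
  have "C \<in> fixed_points (coset_gset G H) N \<longleftrightarrow> N \<subseteq> H" if C: "C \<in> fst (coset_gset G H)" for C
  proof -
    obtain a where a: "a \<in> carrier G" "C = a <# H"
      using C by (auto simp: fst_coset_gset)
    have "C \<in> fixed_points (coset_gset G H) N \<longleftrightarrow> (\<forall>x\<in>N. inv a \<otimes> x \<otimes> a \<in> H)"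
      using C NG a by (auto simp: fixed_points_iff_stabilizer stabilizer_coset_gset[OF H])
    also have "\<dots> \<longleftrightarrow> N \<subseteq> H"
    proof
      assume *: "\<forall>x\<in>N. inv a \<otimes> x \<otimes> a \<in> H"
      show "N \<subseteq> H"
      proof
        fix x assume x: "x \<in> N"
        \<comment> \<open>Testing the hypothesis on \<open>a x a^-1\<close> undoes the conjugation
          by \<open>a\<close>.\<close>
        then have "inv (inv a) \<otimes> x \<otimes> inv a \<in> N"
          using a(1) by (intro normal_conj_mem[OF N]) auto
        then have "inv a \<otimes> (inv (inv a) \<otimes> x \<otimes> inv a) \<otimes> a \<in> H"
          using * by blast
        then show "x \<in> H"
          using x a(1) NG by (simp add: m_assoc subset_iff flip: m_assoc[of "inv a" a])
      qed
    qed (use normal_conj_mem[OF N a(1)] in blast)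
    finally show ?thesis .
  qed
  moreover have "fixed_points (coset_gset G H) N \<subseteq> fst (coset_gset G H)"
    by (auto simp: fixed_points_def)
  ultimately show ?thesis
    by auto
qed

lemma fixed_points_generate_insert:
  assumes X: "finite_gset G X" and g: "g \<in> carrier G" and N: "N \<subseteq> carrier G"
  shows "fixed_points X (generate G (insert g N)) = {x \<in> fixed_points X N. snd X g x = x}"
proof -
  have gen: "generate G (insert g N) \<subseteq> S \<longleftrightarrow> insert g N \<subseteq> S" if "subgroup S G" for S
    using generate_subgroup_incl[OF _ that] generate.incl[of _ "insert g N" G] by blast
  have "x \<in> fixed_points X (generate G (insert g N)) \<longleftrightarrow> x \<in> fixed_points X N \<and> snd X g x = x"
    for x
    using g N gen[OF subgroup_stabilizer[OF X]] generate_incl[of "insert g N"]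
    by (auto simp: fixed_points_iff_stabilizer stabilizer_def)
  then show ?thesis
    by blast
qed

text \<open>By Burnside's lemma, for a \<open>G\<close>-set \<open>X\<close> this is \<open>order G\<close> times the number of orbits of
  \<open>G\<close> on the \<open>N\<close>-fixed points of \<open>X\<close>.\<close>
definition mark_sum :: "'a set \<Rightarrow> 'a virtual_gset \<Rightarrow> int" where
  "mark_sum N u = (\<Sum>g\<in>carrier G. mark G (generate G (insert g N)) u)"

text \<open>If \<open>N \<subseteq> H\<close>, then \<open>N\<close> fixes every point of
  \<open>G/H\<close> and Burnside's lemma counts the single orbit; otherwise \<open>N\<close> has no
  fixed points and all summands vanish.\<close>

lemma mark_sum_coset:
  assumes N: "N \<lhd> G" and H: "subgroup H G"
  shows "mark_sum N (gset_class G (coset_gset G H)) = (if N \<subseteq> H then int (order G) else 0)"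
proof -
  let ?X = "coset_gset G H"
  note X = finite_gset_coset[OF H]
  have NG: "N \<subseteq> carrier G"
    by (rule subgroup.subset[OF normal_imp_subgroup[OF N]])
  have sg: "subgroup (generate G (insert g N)) G" if "g \<in> carrier G" for g
    using that NG by (intro generate_is_subgroup) auto
  interpret group_action G "fst ?X" "snd ?X"
    by (rule gset_action[OF X])
  have "mark_sum N (gset_class G ?X) = (\<Sum>g\<in>carrier G. int (card {x \<in> fixed_points ?X N. snd ?X g x = x}))"
    unfolding mark_sum_def
    by (intro sum.cong refl) (simp add: mark_gset_class X sg fixed_points_generate_insert NG)
  also have "\<dots> = (if N \<subseteq> H then int (order G) else 0)"
  proof (cases "N \<subseteq> H")
    case True
    have "orbit G (snd ?X) x = fst ?X" if "x \<in> fst ?X" for x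
    proof -
      have "H \<in> orbit G (snd ?X) x"
        using that subgroup_in_coset_gset[OF H] orbit_sym[of H x] orbit_coset_gset_self[OF H] by blast
      then show ?thesis
        using that orbit_trans[of x H] subgroup_in_coset_gset[OF H] orbit_coset_gset_self[OF H]
          orbit_subset[OF X that] by blast
    qed
    then have "orbits G (fst ?X) (snd ?X) = {fst ?X}"
      using subgroup_in_coset_gset[OF H] by (auto simp: orbits_def)
    then have "order G = (\<Sum>g\<in>carrier G. card (invariants (fst ?X) (snd ?X) g))"
      using burnside[OF finite_carrier gset_finite[OF X]] by simp
    then show ?thesis
      using True by (simp add: fixed_points_coset_gset_of_normal[OF N H] invariants_def)
  next
    case False
    then show ?thesis
      by (simp add: fixed_points_coset_gset_of_normal[OF N H])
  qed
  finally show ?thesis .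
qed

lemma mark_sum_add:
  assumes "u \<in> carrier B" "v \<in> carrier B" "N \<subseteq> carrier G"
  shows "mark_sum N (u \<oplus>\<^bsub>B\<^esub> v) = mark_sum N u + mark_sum N v"
  unfolding mark_sum_def sum.distrib[symmetric]
  using assms by (intro sum.cong refl mark_add generate_is_subgroup) auto

text \<open>A characterisation of the core compression \<open>v\<close> of \<open>u\<close> that does not mention bases: the
  first clause says that \<open>v\<close> is a combination of the \<open>[G/N]\<close> with \<open>N\<close> normal, and the second that
  \<open>u\<close> and \<open>v\<close> have the same orbit counts.\<close>
definition compresses_to :: "'a virtual_gset \<Rightarrow> 'a virtual_gset \<Rightarrow> bool" where
  "compresses_to u v \<longleftrightarrow>
    (\<forall>K. subgroup K G \<longrightarrow> mark G K v = mark G (normal_closure G K) v) \<and>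
    (\<forall>N. N \<lhd> G \<longrightarrow> mark_sum N v = mark_sum N u)"

text \<open>The first clause holds because the core is normal, the second because a normal
  \<open>N\<close> lies in \<open>H\<close> iff it lies in the core.\<close>

lemma compresses_to_coset:
  assumes H: "subgroup H G"
  shows "compresses_to (gset_class G (coset_gset G H)) (gset_class G (coset_gset G (normal_core G H)))"
proof -
  note core = normal_normal_core[OF H]
  note X = finite_gset_coset[OF normal_imp_subgroup[OF core]]
  have "mark G K (gset_class G (coset_gset G (normal_core G H))) =
      mark G (normal_closure G K) (gset_class G (coset_gset G (normal_core G H)))"
    if K: "subgroup K G" for K
  proof -
    note cl = normal_imp_subgroup[OF normal_normal_closure[OF subgroup.subset[OF K]]]
    show ?thesis
      by (simp add: mark_gset_class X K cl fixed_points_coset_gset_normal[OF core]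
          subgroup.subset normal_closure_subset_iff core)
  qed
  then show ?thesis
    using H by (simp add: compresses_to_def mark_sum_coset normal_imp_subgroup[OF core] subset_normal_core_iff)
qed

lemma normal_subset_carrier: "N \<lhd> G \<Longrightarrow> N \<subseteq> carrier G"
  by (rule subgroup.subset[OF normal_imp_subgroup])

lemma subgroup_normal_closure: "subgroup K G \<Longrightarrow> subgroup (normal_closure G K) G"
  by (rule normal_imp_subgroup[OF normal_normal_closure[OF subgroup.subset]])

lemma compresses_to_add:
  assumes "u \<in> carrier B" "v \<in> carrier B" "u' \<in> carrier B" "v' \<in> carrier B"
    and "compresses_to u u'" "compresses_to v v'"
  shows "compresses_to (u \<oplus>\<^bsub>B\<^esub> v) (u' \<oplus>\<^bsub>B\<^esub> v')"
  using assms unfolding compresses_to_def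
  by (simp add: mark_add mark_sum_add normal_subset_carrier subgroup_normal_closure)

text \<open>Both clauses are equations between additive functions, so the contribution of
  \<open>v\<close> cancels; this serves the case \<open>diff\<close> of
  \<open>burnside_induct\<close>.\<close>

lemma compresses_to_diff:
  assumes "u \<in> carrier B" "v \<in> carrier B" "u' \<in> carrier B" "v' \<in> carrier B"
    and add: "compresses_to (u \<oplus>\<^bsub>B\<^esub> v) (u' \<oplus>\<^bsub>B\<^esub> v')" and v: "compresses_to v v'"
  shows "compresses_to u u'"
  unfolding compresses_to_def
proof (intro conjI allI impI)
  fix K assume K: "subgroup K G"
  then have "mark G K u' + mark G K v' = mark G (normal_closure G K) u' + mark G (normal_closure G K) v'"
    using add assms(1-4) subgroup_normal_closure[OF K] unfolding compresses_to_def
    by (metis mark_add)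
  then show "mark G K u' = mark G (normal_closure G K) u'"
    using v K unfolding compresses_to_def by simp
next
  fix N assume N: "N \<lhd> G"
  then have "mark_sum N u' + mark_sum N v' = mark_sum N u + mark_sum N v"
    using add assms(1-4) normal_subset_carrier[OF N] unfolding compresses_to_def
    by (metis mark_sum_add)
  then show "mark_sum N u' = mark_sum N u"
    using v N unfolding compresses_to_def by simp
qed

section \<open>Uniqueness and existence of the compression\<close>

lemma generate_insert_mem:
  assumes "subgroup N G" "g \<in> N"
  shows "generate G (insert g N) = N"
  using assms generate_subgroup_incl[of N N] generate.incl[of _ N G]
  by (auto simp: insert_absorb)

text \<open>In \<open>mark_sum N\<close> the terms with \<open>g \<in> N\<close> add up to
  \<open>card N\<close> times the mark at \<open>N\<close>, and the others equal marks at strictly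
  larger normal subgroups. So the sums determine the marks at normal subgroups, and these determine
  all marks by the first clause.\<close>

lemma compresses_to_unique:
  assumes v: "v \<in> carrier B" "compresses_to u v" and w: "w \<in> carrier B" "compresses_to u w"
  shows "v = w"
proof -
  have normal_eq: "mark G N v = mark G N w" if "N \<lhd> G" for N
    using that
  proof (induction "card (carrier G - N)" arbitrary: N rule: less_induct)
    case less
    note N = less.prems
    note NG = normal_subset_carrier[OF N]
    \<comment> \<open>The mark at \<open><N,g>\<close> equals that at its normal closure, which
      contains \<open>N\<close> and the new element \<open>g\<close>, so the induction hypothesis
      applies.\<close>
    have out: "mark G (generate G (insert g N)) v = mark G (generate G (insert g N)) w"
      if g: "g \<in> carrier G - N" for g
    proof -
      let ?K = "generate G (insert g N)"
      let ?M = "normal_closure G ?K"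
      have K: "subgroup ?K G"
        using g NG by (intro generate_is_subgroup) auto
      have "insert g N \<subseteq> ?M"
        using subset_normal_closure[of ?K] generate.incl[of _ "insert g N" G] by blast
      then have "carrier G - ?M \<subset> carrier G - N"
        using g by blast
      then have "card (carrier G - ?M) < card (carrier G - N)"
        using finite_carrier by (intro psubset_card_mono) auto
      then have "mark G ?M v = mark G ?M w"
        using less.hyps normal_normal_closure[OF subgroup.subset[OF K]] by blast
      then show ?thesis
        using v(2) w(2) K unfolding compresses_to_def by simp
    qed
    have split: "mark_sum N x = int (card N) * mark G N x +
        (\<Sum>g\<in>carrier G - N. mark G (generate G (insert g N)) x)" for x
    proof -
      have "(\<Sum>g\<in>N. mark G (generate G (insert g N)) x) = (\<Sum>g\<in>N. mark G N x)"
        using generate_insert_mem[OF normal_imp_subgroup[OF N]] by (intro sum.cong) auto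
      then show ?thesis
        unfolding mark_sum_def by (subst sum.subset_diff[OF NG finite_carrier]) (simp add: add.commute)
    qed
    have "mark_sum N v = mark_sum N w"
      using v(2) w(2) N unfolding compresses_to_def by simp
    then have "int (card N) * mark G N v = int (card N) * mark G N w"
      using out by (simp add: split)
    moreover have "card N > 0"
      using subgroup.one_closed[OF normal_imp_subgroup[OF N]] finite_subset[OF NG finite_carrier]
      by (auto simp: card_gt_0_iff)
    ultimately show ?case by simp
  qed
  have "mark G K v = mark G K w" if K: "subgroup K G" for K
    using v(2) w(2) K normal_eq[OF normal_normal_closure[OF subgroup.subset[OF K]]]
    unfolding compresses_to_def by simp
  then show ?thesis
    by (rule burnside_eqI[OF v(1) w(1)])
qed

lemma ex_compresses_to:
  assumes "u \<in> carrier B"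
  shows "\<exists>v\<in>carrier B. compresses_to u v"
  using assms
proof (induction u rule: burnside_induct)
  case (coset H)
  then show ?case
    using compresses_to_coset gset_class_in_carrier[OF finite_gset_coset]
      normal_imp_subgroup[OF normal_normal_core] by blast
next
  case (add u v)
  then show ?case
    using compresses_to_add burnside_add_closed by blast
next
  case (diff u v)
  then obtain w v' where w: "w \<in> carrier B" "compresses_to (u \<oplus>\<^bsub>B\<^esub> v) w"
    and v': "v' \<in> carrier B" "compresses_to v v'"
    by blast
  obtain u' where u': "u' \<in> carrier B" "\<And>K. subgroup K G \<Longrightarrow> mark G K u' = mark G K w - mark G K v'"
    using ex_burnside_diff[OF w(1) v'(1)] by blast
  then have "u' \<oplus>\<^bsub>B\<^esub> v' = w"
    using v' w by (intro burnside_eqI burnside_add_closed) (simp_all add: mark_add)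
  then show ?case
    using compresses_to_diff[OF diff(1,2) u'(1) v'(1)] w v' u'(1) by blast
qed

text \<open>Shows that the definite description in \<open>core_compression\<close> denotes: choosing
  compressions gives a map of the required kind, and any such map sends each element to its unique
  compression, by induction over the generators.\<close>

lemma core_compression:
  assumes "u \<in> carrier B"
  shows "core_compression G u \<in> carrier B \<and> compresses_to u (core_compression G u)"
proof -
  let ?P = "\<lambda>n. n \<in> extensional (carrier B) \<and> n \<in> hom (add_monoid B) (add_monoid B) \<and>
    (\<forall>H. subgroup H G \<longrightarrow>
      n (gset_class G (coset_gset G H)) = gset_class G (coset_gset G (normal_core G H)))"
  have spec: "n u \<in> carrier B \<and> compresses_to u (n u)" if n: "?P n" and u: "u \<in> carrier B" for n u
  proof -
    have closed: "n u \<in> carrier B" if "u \<in> carrier B" for u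
      using n that by (auto simp: hom_def)
    have n_add: "n (u \<oplus>\<^bsub>B\<^esub> v) = n u \<oplus>\<^bsub>B\<^esub> n v" if "u \<in> carrier B" "v \<in> carrier B" for u v
      using n that by (auto simp: hom_def)
    from u have "compresses_to u (n u)"
    proof (induction u rule: burnside_induct)
      case (coset H)
      then show ?case
        using n compresses_to_coset by simp
    next
      case (add u v)
      then show ?case
        using compresses_to_add closed n_add by simp
    next
      case (diff u v)
      then show ?case
        using compresses_to_diff[OF diff(1,2) closed[OF diff(1)] closed[OF diff(2)]] n_add by simp
    qed
    then show ?thesis
      using closed[OF u] by blast
  qed
  define n where "n = (\<lambda>u\<in>carrier B. SOME v. v \<in> carrier B \<and> compresses_to u v)"
  have n: "n u \<in> carrier B" "compresses_to u (n u)" if "u \<in> carrier B" for u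
    using someI_ex[of "\<lambda>v. v \<in> carrier B \<and> compresses_to u v"] ex_compresses_to[OF that] that
    by (auto simp: n_def)
  have "?P n"
  proof (intro conjI allI impI)
    show "n \<in> extensional (carrier B)"
      by (simp add: n_def)
    \<comment> \<open>Both sides compress \<open>u + v\<close>, so uniqueness identifies
      them.\<close>
    have "n (u \<oplus>\<^bsub>B\<^esub> v) = n u \<oplus>\<^bsub>B\<^esub> n v" if "u \<in> carrier B" "v \<in> carrier B" for u v
      using that
      by (intro compresses_to_unique[of _ "u \<oplus>\<^bsub>B\<^esub> v"] compresses_to_add n burnside_add_closed) auto
    then show "n \<in> hom (add_monoid B) (add_monoid B)"
      using n by (auto simp: hom_def)
    fix H assume H: "subgroup H G"
    show "n (gset_class G (coset_gset G H)) = gset_class G (coset_gset G (normal_core G H))"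
      by (rule compresses_to_unique[OF n _ compresses_to_coset[OF H]])
        (auto intro!: gset_class_in_carrier finite_gset_coset H normal_imp_subgroup[OF normal_normal_core])
  qed
  moreover have "n' = n" if n': "?P n'" for n'
  proof (rule extensionalityI[of _ "carrier B"])
    show "n' u = n u" if "u \<in> carrier B" for u
      using spec[OF n' that] n[OF that] compresses_to_unique by blast
  qed (use n' in \<open>auto simp: n_def\<close>)
  ultimately have "?P (core_compression G)"
    unfolding core_compression_def by (rule theI)
  then show ?thesis
    using spec assms by blast
qed

end

section \<open>Core-cyclic subgroups and the kernel\<close>

text \<open>The definition compares whole group structures, but these can differ only in their
  carriers.\<close>

lemma (in group) cyclic_group_iff_generate:
  "cyclic_group G \<longleftrightarrow> (\<exists>x\<in>carrier G. generate G {x} = carrier G)"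
proof -
  have "subgroup_generated G {x} = G \<longleftrightarrow> generate G {x} = carrier G" if "x \<in> carrier G" for x
  proof
    assume "subgroup_generated G {x} = G"
    then show "generate G {x} = carrier G"
      using that carrier_subgroup_generated[of G "{x}"] by simp
  next
    assume "generate G {x} = carrier G"
    then show "subgroup_generated G {x} = G"
      using that by (simp add: subgroup_generated_def)
  qed
  then show ?thesis
    by (auto simp: cyclic_group_def)
qed

context finite_group
begin

text \<open>Generation lifts through the quotient: the projection commutes with
  \<open>generate\<close>, and \<open>N\<close> is its kernel.\<close>

lemma generate_coset_iff:
  assumes H: "subgroup H G" and N: "N \<lhd> G" "N \<subseteq> H" and g: "g \<in> H"
  shows "generate (G\<lparr>carrier := H\<rparr> Mod N) {N #> g} = carrier (G\<lparr>carrier := H\<rparr> Mod N) \<longleftrightarrow>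
    generate G (insert g N) = H"
proof -
  let ?H = "G\<lparr>carrier := H\<rparr>"
  let ?Q = "?H Mod N"
  let ?h = "\<lambda>a. N #> a"
  have NH: "N \<lhd> ?H"
    using normal_restrict_supergroup[OF H N] .
  then interpret NH: normal N ?H .
  interpret Q: group ?Q
    by (rule NH.factorgroup_is_group)
  have hom: "?h \<in> hom ?H ?Q"
    using NH.r_coset_hom_Mod by simp
  interpret h: group_hom ?H ?Q ?h
    using hom NH.is_group Q.is_group by (simp add: group_hom_def group_hom_axioms_def)
  have carrier_Q: "carrier ?Q = ?h ` H"
    by (simp add: carrier_FactGroup)
  have gen: "generate ?Q (?h ` K) = ?h ` generate G K" if "K \<subseteq> H" for K
    using h.generate_img[of K] generate_consistent[OF that H] that by simp
  have NG: "subgroup N G"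
    using N(1) by (rule normal_imp_subgroup)
  have ins: "insert g N \<subseteq> carrier G"
    using subgroup.subset[OF H] g N by blast
  show ?thesis
  proof
    assume *: "generate ?Q {N #> g} = carrier ?Q"
    have "H \<subseteq> generate G (insert g N)"
    proof
      fix x assume x: "x \<in> H"
      \<comment> \<open>In the quotient \<open>x\<close> agrees with some \<open>y\<close> generated
        by \<open>g\<close>, so \<open>x\<close> differs from \<open>y\<close> by an element of
        \<open>N\<close>.\<close>
      then have "N #> x \<in> ?h ` generate G {g}"
        using * gen[of "{g}"] g unfolding carrier_Q by simp (use x in blast)
      then obtain y where y: "y \<in> generate G {g}" "N #> x = N #> y"
        by blast
      then have "x \<in> N #> y"
        using rcos_self[OF _ NG, of x] subgroup.subset[OF H] x by auto
      then obtain n where n: "n \<in> N" "x = n \<otimes> y"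
        by (auto simp: r_coset_def)
      have "y \<in> generate G (insert g N)"
        using y(1) mono_generate[of "{g}" "insert g N"] by auto
      then show "x \<in> generate G (insert g N)"
        unfolding n(2) using n(1) by (simp add: generate.eng generate.incl)
    qed
    moreover have "generate G (insert g N) \<subseteq> H"
      using H N g by (intro generate_subgroup_incl) auto
    ultimately show "generate G (insert g N) = H"
      by blast
  next
    assume *: "generate G (insert g N) = H"
    \<comment> \<open>Elements of \<open>N\<close> become the identity of the quotient, so the image
      of \<open>g\<close> alone generates it.\<close>
    have "N #> n = N" if "n \<in> N" for n
      using that subgroup.subset[OF NG] coset_join2[OF _ NG] by blast
    then have "carrier ?Q = generate ?Q (insert (N #> g) (?h ` N))"
      using gen[of "insert g N"] N g by (simp add: carrier_Q *)
    also have "\<dots> \<subseteq> generate ?Q {N #> g}"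
    proof (rule Q.generate_subgroup_incl)
      show sub: "subgroup (generate ?Q {N #> g}) ?Q"
        using g by (intro Q.generate_is_subgroup) (auto simp: carrier_Q)
      have "?h n \<in> generate ?Q {N #> g}" if "n \<in> N" for n
        using subgroup.one_closed[OF sub] \<open>\<And>n. n \<in> N \<Longrightarrow> N #> n = N\<close>[OF that] by simp
      then show "insert (N #> g) (?h ` N) \<subseteq> generate ?Q {N #> g}"
        by (auto intro: generate.incl)
    qed
    finally show "generate ?Q {N #> g} = carrier ?Q"
      using Q.generate_incl[of "{N #> g}"] g by (auto simp: carrier_Q)
  qed
qed

text \<open>From left to right, \<open>N\<close> is the core and \<open>g\<close> lifts a generator
  of the quotient. Conversely such an \<open>N\<close> lies in the core of \<open>H\<close>, so
  replacing it by the core still generates \<open>H\<close>. The marks in the sums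
  \<open>mark_sum\<close> are thus those at core-cyclic subgroups.\<close>

lemma core_cyclic_iff:
  "core_cyclic G H \<longleftrightarrow> (\<exists>N g. N \<lhd> G \<and> g \<in> carrier G \<and> H = generate G (insert g N))"
proof -
  have *: "core_cyclic G H \<longleftrightarrow> (\<exists>g\<in>H. generate G (insert g (normal_core G H)) = H)"
    if H: "subgroup H G"
  proof -
    let ?C = "normal_core G H"
    let ?Q = "G\<lparr>carrier := H\<rparr> Mod ?C"
    note C = normal_normal_core[OF H] normal_core_subset[OF H]
    interpret Q: group ?Q
      using normal.factorgroup_is_group[OF normal_restrict_supergroup[OF H C]] .
    have "carrier ?Q = (\<lambda>a. ?C #> a) ` H"
      by (simp add: carrier_FactGroup)
    then show ?thesis
      using H generate_coset_iff[OF H C] by (auto simp: core_cyclic_def Q.cyclic_group_iff_generate)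
  qed
  show ?thesis
  proof
    assume "core_cyclic G H"
    moreover from this have H: "subgroup H G"
      by (simp add: core_cyclic_def)
    ultimately obtain g where "g \<in> H" "generate G (insert g (normal_core G H)) = H"
      using * by blast
    then show "\<exists>N g. N \<lhd> G \<and> g \<in> carrier G \<and> H = generate G (insert g N)"
      using normal_normal_core[OF H] subgroup.subset[OF H] by blast
  next
    assume "\<exists>N g. N \<lhd> G \<and> g \<in> carrier G \<and> H = generate G (insert g N)"
    then obtain N g where N: "N \<lhd> G" and g: "g \<in> carrier G" and H_eq: "H = generate G (insert g N)"
      by blast
    have H: "subgroup H G"
      unfolding H_eq using g normal_subset_carrier[OF N] by (intro generate_is_subgroup) auto
    have mem: "g \<in> H" "N \<subseteq> H"
      unfolding H_eq by (auto intro: generate.incl)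
    then have "N \<subseteq> normal_core G H"
      using subset_normal_core_iff[OF N H] by blast
    then have "H \<subseteq> generate G (insert g (normal_core G H))"
      unfolding H_eq[symmetric] by (subst H_eq) (auto intro!: mono_generate)
    moreover have "generate G (insert g (normal_core G H)) \<subseteq> H"
      using mem normal_core_subset[OF H] H by (intro generate_subgroup_incl) auto
    ultimately show "core_cyclic G H"
      using *[OF H] mem(1) by blast
  qed
qed

section \<open>Units, trivial compression and the kernel of \<open>Psi\<close>\<close>

lemma
  shows burnside_one_closed: "\<one>\<^bsub>B\<^esub> \<in> carrier B"
    and mark_one: "subgroup K G \<Longrightarrow> mark G K \<one>\<^bsub>B\<^esub> = 1"
    and mark_sum_one: "N \<lhd> G \<Longrightarrow> mark_sum N \<one>\<^bsub>B\<^esub> = int (order G)"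
proof -
  have one: "\<one>\<^bsub>B\<^esub> = gset_class G (coset_gset G (carrier G))"
    by (simp add: burnside_ring_def)
  note X = finite_gset_coset[OF subgroup_self]
  show "\<one>\<^bsub>B\<^esub> \<in> carrier B"
    unfolding one by (rule gset_class_in_carrier[OF X])
  have "a <# carrier G = carrier G" if "a \<in> carrier G" for a
    using coset_join3[OF that subgroup_self that] .
  then have "fst (coset_gset G (carrier G)) = {carrier G}"
    by (auto simp: fst_coset_gset)
  then show "subgroup K G \<Longrightarrow> mark G K \<one>\<^bsub>B\<^esub> = 1"
    unfolding one
    by (simp add: mark_gset_class X fixed_points_coset_gset_normal[OF normal_self] subgroup.subset)
  show "N \<lhd> G \<Longrightarrow> mark_sum N \<one>\<^bsub>B\<^esub> = int (order G)"
    unfolding one by (simp add: mark_sum_coset subgroup_self normal_subset_carrier)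
qed

text \<open>The marks of a unit and of its inverse are integers with product
  \<open>1\<close>.\<close>

lemma mark_unit:
  assumes u: "u \<in> Units B" and K: "subgroup K G"
  shows "mark G K u = 1 \<or> mark G K u = -1"
proof -
  obtain v where "u \<in> carrier B" "v \<in> carrier B" "u \<otimes>\<^bsub>B\<^esub> v = \<one>\<^bsub>B\<^esub>"
    using u by (auto simp: Units_def)
  then have "mark G K u * mark G K v = 1"
    using mark_mult[OF _ _ K] mark_one[OF K] by metis
  then show ?thesis
    by (simp add: zmult_eq_1_iff) blast
qed

text \<open>The identity of the ring has all marks \<open>1\<close>, so by uniqueness only the
  equations \<open>mark_sum N u = order G\<close> remain. A sum of \<open>order G\<close> terms,
  each at most \<open>1\<close>, has this value only if every term is \<open>1\<close>.\<close>

lemma core_compression_eq_one_iff: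
  assumes u: "u \<in> Units B"
  shows "core_compression G u = \<one>\<^bsub>B\<^esub> \<longleftrightarrow>
    (\<forall>N g. N \<lhd> G \<longrightarrow> g \<in> carrier G \<longrightarrow> mark G (generate G (insert g N)) u = 1)"
proof -
  have uB: "u \<in> carrier B"
    using u by (simp add: Units_def)
  have "core_compression G u = \<one>\<^bsub>B\<^esub> \<longleftrightarrow> compresses_to u \<one>\<^bsub>B\<^esub>"
    using core_compression[OF uB] burnside_one_closed compresses_to_unique by metis
  also have "\<dots> \<longleftrightarrow> (\<forall>N. N \<lhd> G \<longrightarrow> int (order G) = mark_sum N u)"
    by (simp add: compresses_to_def mark_one mark_sum_one subgroup_normal_closure)
  also have "\<dots> \<longleftrightarrow>
      (\<forall>N. N \<lhd> G \<longrightarrow> (\<forall>g\<in>carrier G. mark G (generate G (insert g N)) u = 1))"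
  proof -
    have "int (order G) = mark_sum N u \<longleftrightarrow> (\<forall>g\<in>carrier G. mark G (generate G (insert g N)) u = 1)"
      if N: "N \<lhd> G" for N
    proof -
      let ?m = "\<lambda>g. mark G (generate G (insert g N)) u"
      have le: "0 \<le> 1 - ?m g" if "g \<in> carrier G" for g
        using mark_unit[OF u generate_is_subgroup[of "insert g N"]] normal_subset_carrier[OF N] that
        by force
      have "int (order G) - mark_sum N u = (\<Sum>g\<in>carrier G. 1 - ?m g)"
        by (simp add: mark_sum_def order_def sum_subtractf)
      then have "int (order G) = mark_sum N u \<longleftrightarrow> (\<Sum>g\<in>carrier G. 1 - ?m g) = 0"
        by linarith
      also have "\<dots> \<longleftrightarrow> (\<forall>g\<in>carrier G. 1 - ?m g = 0)"
        using le by (intro sum_nonneg_eq_0_iff[OF finite_carrier])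
      finally show ?thesis
        by auto
    qed
    then show ?thesis
      by blast
  qed
  finally show ?thesis
    by blast
qed

text \<open>Elements of one coset differ by a factor in \<open>N\<close>, so each lies in the
  subgroup generated by \<open>N\<close> and the other. This makes \<open>unit_character\<close>
  independent of the representative.\<close>

lemma generate_insert_coset:
  assumes N: "N \<lhd> G" and g: "g \<in> carrier G" and h: "h \<in> N #> g"
  shows "generate G (insert h N) = generate G (insert g N)"
proof -
  note NG = normal_imp_subgroup[OF N]
  have sub: "generate G (insert h N) \<subseteq> generate G (insert g N)"
    if g: "g \<in> carrier G" and h: "h \<in> N #> g" for g h
  proof (rule generate_subgroup_incl)
    show "subgroup (generate G (insert g N)) G"
      using g subgroup.subset[OF NG] by (intro generate_is_subgroup) auto
    obtain n where "n \<in> N" "h = n \<otimes> g"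
      using h by (auto simp: r_coset_def)
    then have "h \<in> generate G (insert g N)"
      by (simp add: generate.eng generate.incl)
    then show "insert h N \<subseteq> generate G (insert g N)"
      by (auto intro: generate.incl)
  qed
  have "h \<in> carrier G"
    using subgroup.elemrcos_carrier[OF NG is_group g h] .
  moreover have "g \<in> N #> h"
    using repr_independence[OF h g NG] rcos_self[OF g NG] by simp
  ultimately show ?thesis
    using sub g h by blast
qed

lemma unit_character_coset:
  assumes N: "N \<lhd> G" and g: "g \<in> carrier G"
  shows "unit_character G N u (N #> g) = mark G (generate G (insert g N)) u div mark G N u"
proof -
  have "(\<lambda>h. mark G (generate G (insert h N)) u div mark G N u) ` (N #> g) =
      (\<lambda>_. mark G (generate G (insert g N)) u div mark G N u) ` (N #> g)"
    by (intro image_cong refl) (simp add: generate_insert_coset[OF N g])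
  also have "\<dots> = {mark G (generate G (insert g N)) u div mark G N u}"
    using rcos_self[OF g normal_imp_subgroup[OF N]] by auto
  finally show ?thesis
    using g by (simp add: unit_character_def carrier_FactGroup)
qed

text \<open>Triviality at \<open>N\<close> says that the mark at \<open>N\<close> and all quotients
  are \<open>1\<close>; division by that mark then changes nothing, so the marks at all
  \<open><N,g>\<close> are \<open>1\<close>.\<close>

lemma Psi_eq_one_iff:
  "Psi G u = \<one>\<^bsub>Psi_target G\<^esub> \<longleftrightarrow>
    (\<forall>N g. N \<lhd> G \<longrightarrow> g \<in> carrier G \<longrightarrow> mark G (generate G (insert g N)) u = 1)"
proof -
  have char_iff: "unit_character G N u = (\<lambda>C\<in>carrier (G Mod N). 1) \<longleftrightarrow>
      (\<forall>g\<in>carrier G. mark G (generate G (insert g N)) u div mark G N u = 1)" if N: "N \<lhd> G" for N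
  proof -
    have "unit_character G N u = (\<lambda>C\<in>carrier (G Mod N). 1) \<longleftrightarrow>
        (\<forall>C\<in>carrier (G Mod N). unit_character G N u C = 1)"
      by (auto simp: unit_character_def fun_eq_iff)
    then show ?thesis
      by (simp add: carrier_FactGroup unit_character_coset[OF N])
  qed
  \<comment> \<open>The case \<open>g = \<one>\<close> recovers the mark at \<open>N\<close>, so
    this condition is absorbed into the others.\<close>
  have at_N: "mark G (generate G (insert \<one> N)) u = mark G N u" if "N \<lhd> G" for N
    using generate_insert_mem[of N \<one>] normal_imp_subgroup[OF that] by (simp add: subgroup.one_closed)
  have "Psi G u = \<one>\<^bsub>Psi_target G\<^esub> \<longleftrightarrow>
      (\<forall>N. N \<lhd> G \<longrightarrow> mark G N u = 1 \<and> unit_character G N u = (\<lambda>C\<in>carrier (G Mod N). 1))"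
    by (auto simp: Psi_def Psi_target_def sign_img_def sign_characters_def fun_eq_iff restrict_def)
  also have "\<dots> \<longleftrightarrow>
      (\<forall>N. N \<lhd> G \<longrightarrow> mark G N u = 1 \<and> (\<forall>g\<in>carrier G. mark G (generate G (insert g N)) u = 1))"
    using char_iff by auto
  also have "\<dots> \<longleftrightarrow>
      (\<forall>N g. N \<lhd> G \<longrightarrow> g \<in> carrier G \<longrightarrow> mark G (generate G (insert g N)) u = 1)"
    using at_N one_closed by metis
  finally show ?thesis .
qed

end

theorem theorem5p6:
  fixes G :: "('a, 'm) monoid_scheme"
  assumes "group G" and "finite (carrier G)"
  shows "U_core G = kernel (units_of (burnside_ring G)) (Psi_target G) (Psi G) \<and>
         kernel (units_of (burnside_ring G)) (Psi_target G) (Psi G) =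
           {u \<in> Units (burnside_ring G). \<forall>H. core_cyclic G H \<longrightarrow> mark G H u = 1}"
proof -
  interpret finite_group G
    using assms by (simp add: finite_group_def finite_group_axioms_def)
  \<comment> \<open>The common condition: each of the three sets turns out to be the set of units
    satisfying \<open>?A\<close>.\<close>
  let ?A = "\<lambda>u. \<forall>N g. N \<lhd> G \<longrightarrow> g \<in> carrier G \<longrightarrow> mark G (generate G (insert g N)) u = 1"
  have "U_core G = {u \<in> Units (burnside_ring G). ?A u}"
    using core_compression_eq_one_iff by (auto simp: U_core_def)
  moreover have "kernel (units_of (burnside_ring G)) (Psi_target G) (Psi G) =
      {u \<in> Units (burnside_ring G). ?A u}"
    by (auto simp: kernel_def units_of_carrier Psi_eq_one_iff)
  moreover have "(\<forall>H. core_cyclic G H \<longrightarrow> mark G H u = 1) \<longleftrightarrow> ?A u" for u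
    unfolding core_cyclic_iff by blast
  ultimately show ?thesis
    by simp
qed

end
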